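(* Let $\beta>2$, $q$ an integer with $\beta\sin^2(\frac{\pi}{q})<1$ and $\beta\big(1-\frac{q}{2\pi}\sin(\frac{2\pi}{q})\big)\le2$. Let $eq=\frac1q\sum_{k=1}^q\delta_k$ and $V=\{\rho\in\mathbb R^q:\sum_k\rho(k)=0\}$. Then the linearization $L:V\to V$, $L\rho=\frac{d}{d\varepsilon}\big|_{\varepsilon=0}F(eq+\varepsilon\rho)$, has exactly two eigenvalues (a complex-conjugate pair, counted with multiplicity) with positive real part, all its other eigenvalues have negative real part, and the corresponding two-dimensional unstable subspace is $\{\rho\in V:\sum_{k=1}^q\rho(k)e^{i\frac{2\pi}{q}lk}=0\ \text{for all } l\in\{2,\dots,q-2\}\}$. Equivalently, the locally non-attractive manifold of the equidistribution is $$\Big\{\nu'\in\mathcal P(\{1,\dots,q\}):\sum_{k=1}^q\nu'(k)e^{i\frac{2\pi}{q}lk}=0\ \text{for all } l\in\{2,\dots,q-2\}\Big\}.$$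
   Context: Scalar-product model: $S^1\cong[0,2\pi)$, $\alpha$ Lebesgue measure, $e_s=(\cos s,\sin s)$, $\Phi(\nu)=-\frac\beta2\|\int e_s\nu(ds)\|^2$, $S(\nu|\alpha)$ relative entropy. $S_k=[\tfrac{2\pi}{q}(k-1),\tfrac{2\pi}{q}k)$, $T(\nu)(k)=\nu(S_k)$, indices modulo $q$. For $\nu'\in\mathcal P(\{1,\dots,q\})$, $\nu^{\nu'}$ is the unique minimizer of $\Phi+S(\cdot|\alpha)$ over $\{\nu:T(\nu)=\nu'\}$, $M_\beta(\nu')=\int e_\omega\nu^{\nu'}(d\omega)$, $c(k,\nu')=e^{\beta\langle e_{2\pi k/q},M_\beta(\nu')\rangle}/\int_{S_k}e^{\beta\langle e_\omega,M_\beta(\nu')\rangle}\alpha(d\omega)$, and $F(\nu')(k)=c(k-1,\nu')\nu'(k-1)-c(k,\nu')\nu'(k)$ is the vector field of the flow $\frac{d}{dt}\phi=F(\phi)$ on $\mathcal P(\{1,\dots,q\})$. *)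

theory Defs
  imports "HOL-Analysis.Set_Integral" "HOL-Analysis.Lebesgue_Measure" "Jordan_Normal_Form.Char_Poly"
begin

definition sector :: "nat \<Rightarrow> nat \<Rightarrow> real set" where
  "sector q k = {2*pi/real q * (real k - 1) ..< 2*pi/real q * real k}"

text \<open>Probability measures on [0,2pi) with finite relative entropy w.r.t. Lebesgue
  measure alpha, represented by their densities f.\<close>
definition admissible_density :: "(real \<Rightarrow> real) \<Rightarrow> bool" where
  "admissible_density f \<longleftrightarrow> f \<in> borel_measurable lborel
     \<and> (\<forall>s\<in>{0..<2*pi}. 0 \<le> f s)
     \<and> set_integrable lborel {0..<2*pi} f
     \<and> set_integrable lborel {0..<2*pi} (\<lambda>s. f s * ln (f s))"

definition Tproj :: "nat \<Rightarrow> (real \<Rightarrow> real) \<Rightarrow> nat \<Rightarrow> real" where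
  "Tproj q f k = (LINT s:sector q k|lborel. f s)"

definition rel_entropy :: "(real \<Rightarrow> real) \<Rightarrow> real" where
  "rel_entropy f = (LINT s:{0..<2*pi}|lborel. f s * ln (f s))"

definition magn :: "(real \<Rightarrow> real) \<Rightarrow> real \<times> real" where
  "magn f = ((LINT s:{0..<2*pi}|lborel. cos s * f s), (LINT s:{0..<2*pi}|lborel. sin s * f s))"

definition Phi :: "real \<Rightarrow> (real \<Rightarrow> real) \<Rightarrow> real" where
  "Phi \<beta> f = - \<beta> / 2 * (fst (magn f)^2 + snd (magn f)^2)"

definition free_energy :: "real \<Rightarrow> (real \<Rightarrow> real) \<Rightarrow> real" where
  "free_energy \<beta> f = Phi \<beta> f + rel_entropy f"

definition prob_vec :: "nat \<Rightarrow> (nat \<Rightarrow> real) \<Rightarrow> bool" where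
  "prob_vec q p \<longleftrightarrow> (\<forall>k\<in>{1..q}. 0 \<le> p k) \<and> (\<forall>k. k \<notin> {1..q} \<longrightarrow> p k = 0)
                     \<and> (\<Sum>k=1..q. p k) = 1"

text \<open>nu^{nu'} minimises Phi + S(.|alpha) over {nu : T(nu) = nu'};
  M_beta(nu') = int e_omega nu^{nu'}(d omega).  The minimiser is unique (as a measure,
  i.e. up to a.e. equality of densities), hence its magnetisation is uniquely determined.\<close>
definition is_constrained_minimizer :: "real \<Rightarrow> nat \<Rightarrow> (nat \<Rightarrow> real) \<Rightarrow> (real \<Rightarrow> real) \<Rightarrow> bool" where
  "is_constrained_minimizer \<beta> q p f \<longleftrightarrow>
     admissible_density f \<and> (\<forall>k\<in>{1..q}. Tproj q f k = p k) \<and>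
     (\<forall>g. admissible_density g \<and> (\<forall>k\<in>{1..q}. Tproj q g k = p k)
           \<longrightarrow> free_energy \<beta> f \<le> free_energy \<beta> g)"

definition M_beta :: "real \<Rightarrow> nat \<Rightarrow> (nat \<Rightarrow> real) \<Rightarrow> real \<times> real" where
  "M_beta \<beta> q p = (THE m. \<exists>f. is_constrained_minimizer \<beta> q p f \<and> m = magn f)"

definition e_vec :: "real \<Rightarrow> real \<times> real" where
  "e_vec s = (cos s, sin s)"

definition inner2 :: "real \<times> real \<Rightarrow> real \<times> real \<Rightarrow> real" where
  "inner2 x y = fst x * fst y + snd x * snd y"

text \<open>c(k,nu'), for k in {1..q} (index 0 is identified with q).\<close>
definition c_rate :: "real \<Rightarrow> nat \<Rightarrow> nat \<Rightarrow> (nat \<Rightarrow> real) \<Rightarrow> real" where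
  "c_rate \<beta> q k p =
     exp (\<beta> * inner2 (e_vec (2*pi*real k / real q)) (M_beta \<beta> q p)) /
     (LINT \<omega>:sector q k|lborel. exp (\<beta> * inner2 (e_vec \<omega>) (M_beta \<beta> q p)))"

definition prev_idx :: "nat \<Rightarrow> nat \<Rightarrow> nat" where
  "prev_idx q k = (if k = 1 then q else k - 1)"

definition F_field :: "real \<Rightarrow> nat \<Rightarrow> (nat \<Rightarrow> real) \<Rightarrow> nat \<Rightarrow> real" where
  "F_field \<beta> q p k = (if k \<in> {1..q} then
       c_rate \<beta> q (prev_idx q k) p * p (prev_idx q k) - c_rate \<beta> q k p * p k
     else 0)"

definition eqdist :: "nat \<Rightarrow> nat \<Rightarrow> real" where
  "eqdist q k = (if k \<in> {1..q} then 1 / real q else 0)"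

definition Vspace :: "nat \<Rightarrow> (nat \<Rightarrow> real) set" where
  "Vspace q = {\<rho>. (\<forall>k. k \<notin> {1..q} \<longrightarrow> \<rho> k = 0) \<and> (\<Sum>k=1..q. \<rho> k) = 0}"

definition Lin :: "real \<Rightarrow> nat \<Rightarrow> (nat \<Rightarrow> real) \<Rightarrow> nat \<Rightarrow> real" where
  "Lin \<beta> q \<rho> k = deriv (\<lambda>\<epsilon>. F_field \<beta> q (\<lambda>j. eqdist q j + \<epsilon> * \<rho> j) k) 0"

text \<open>Matrix of L : V -> V in the basis b_j = delta_j - delta_q (j = 1..q-1) of V;
  the coordinates of rho in V w.r.t. this basis are rho(1), ..., rho(q-1).
  (0-based matrix indices: row i, column j correspond to i+1, j+1.)\<close>
definition unit_vec :: "nat \<Rightarrow> nat \<Rightarrow> real" where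
  "unit_vec j k = (if k = j then 1 else 0)"

definition Lin_matrix :: "real \<Rightarrow> nat \<Rightarrow> real mat" where
  "Lin_matrix \<beta> q = mat (q-1) (q-1)
     (\<lambda>(i,j). Lin \<beta> q (\<lambda>k. unit_vec (j+1) k - unit_vec q k) (i+1))"

definition coords :: "nat \<Rightarrow> (nat \<Rightarrow> real) \<Rightarrow> real vec" where
  "coords q \<rho> = vec (q-1) (\<lambda>i. \<rho> (i+1))"

text \<open>Unstable subspace of a real n x n matrix A: the real vectors lying in the
  (complex) sum of the generalised eigenspaces of A for eigenvalues with positive real part.\<close>
definition unstable_subspace :: "real mat \<Rightarrow> real vec set" where
  "unstable_subspace A = (let n = dim_row A; Ac = map_mat complex_of_real A in
     {x \<in> carrier_vec n. \<exists>S v. finite S \<and>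
        (\<forall>z\<in>S. 0 < Re z \<and> v z \<in> carrier_vec n \<and>
                 ((Ac - z \<cdot>\<^sub>m 1\<^sub>m n) ^\<^sub>m n) *\<^sub>v v z = 0\<^sub>v n) \<and>
        map_vec complex_of_real x = vec n (\<lambda>i. \<Sum>z\<in>S. v z $ i)})"

end

theory Submission
  imports Defs "HOL-Analysis.Equivalence_Lebesgue_Henstock_Integration"
begin

text \<open>
  Gibbs' inequality, applied with the tilt given by the magnetisation of a competitor, bounds the
  free energy on the fibre over \<open>p\<close> from below by a function \<open>J p\<close> on the plane, whose critical
  points are the fixed points of \<open>total_mean p\<close>, the mean of the Gibbs measure with sector weights \<open>p\<close>.
  Each sector lies in the disc of radius \<open>sin (pi/q)\<close> about the midpoint of its chord, so covariances
  within a sector are at most \<open>sin\<^sup>2 (pi/q)\<close>. As \<open>\<beta> sin\<^sup>2 (pi/q) < 1\<close>, \<open>total_mean p\<close> is a contraction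
  and \<open>J p\<close> is strictly convex; hence \<open>M_beta\<close> is the unique fixed point, and its derivative at the
  equidistribution comes from implicit differentiation.

  The linearisation is then circulant and is diagonalised by the Fourier modes. Only the modes
  \<open>1\<close> and \<open>q - 1\<close> couple to the magnetisation; for the others the eigenvalue is
  \<open>(cis (- \<theta> l) - 1) / \<theta>\<close> with \<open>\<theta> = 2 pi/q\<close>. For the mode \<open>1\<close> the real part is a positive multiple of
  \<open>\<beta> a\<^sup>2 - 2 (1 - r)\<close>, where \<open>a = sin (\<theta>/2) / (\<theta>/2)\<close> and \<open>r = \<beta> (1 - a\<^sup>2) / 2\<close>; this is \<open>\<beta> - 2\<close>.
\<close>

unbundle no vec_syntax
no_notation scalar_prod (infix "\<bullet>" 70)

lemma inner2_eq_inner: "inner2 x y = x \<bullet> y"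
  by (simp add: inner2_def inner_prod_def)

lemma continuous_on_e_vec [continuous_intros]:
  fixes f :: "'a::t2_space \<Rightarrow> real"
  shows "continuous_on S f \<Longrightarrow> continuous_on S (\<lambda>x. e_vec (f x))"
  unfolding e_vec_def by (intro continuous_intros)

lemma norm_e_vec [simp]: "norm (e_vec s) = 1"
  by (simp add: e_vec_def norm_prod_def)

section \<open>Exponentially tilted integrals\<close>

text \<open>Unnormalised moments in the field \<open>h\<close>. With the observable
  \<open>\<phi>\<close> as a parameter, normaliser, means and second moments are instances of one
  integral, and differentiating in \<open>h\<close> stays within the family.\<close>

definition tilt :: "real \<Rightarrow> real \<Rightarrow> real \<Rightarrow> (real \<Rightarrow> real) \<Rightarrow> real \<times> real \<Rightarrow> real" where
  "tilt \<beta> a b \<phi> h = integral {a..b} (\<lambda>s. exp (\<beta> * (h \<bullet> e_vec s)) * \<phi> s)"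

lemma has_derivative_tilt:
  assumes \<phi>: "continuous_on {a..b} \<phi>"
  shows "(tilt \<beta> a b \<phi> has_derivative (\<lambda>w. \<beta> * tilt \<beta> a b (\<lambda>s. (w \<bullet> e_vec s) * \<phi> s) h)) (at h within S)"
proof -
  \<comment> \<open>The derivative of the integrand as a bounded linear functional, the form in
    which \<open>leibniz_rule\<close> takes it.\<close>
  define D where "D = (\<lambda>(x::real \<times> real) t. (exp (\<beta> * (x \<bullet> e_vec t)) * (\<beta> * \<phi> t)) *\<^sub>R blinfun_inner_left (e_vec t))"
  have c: "continuous_on (UNIV \<times> cbox a b) (\<lambda>(x, t). D x t)"
    unfolding D_def split_beta
    by (intro continuous_intros bounded_linear.continuous_on[OF bounded_linear_blinfun_inner_left]
        continuous_on_compose2[OF \<phi>]) auto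
  have "((\<lambda>x. integral (cbox a b) (\<lambda>s. exp (\<beta> * (x \<bullet> e_vec s)) * \<phi> s)) has_derivative
         integral (cbox a b) (D h)) (at h within UNIV)"
  proof (rule leibniz_rule[OF _ _ c])
    fix x t
    show "((\<lambda>x. exp (\<beta> * (x \<bullet> e_vec t)) * \<phi> t) has_derivative blinfun_apply (D x t)) (at x within UNIV)"
      unfolding D_def
      by (auto intro!: derivative_eq_intros simp: blinfun.scaleR_left algebra_simps)
  next
    fix x :: "real \<times> real"
    show "(\<lambda>s. exp (\<beta> * (x \<bullet> e_vec s)) * \<phi> s) integrable_on cbox a b"
      using \<phi> by (intro integrable_continuous continuous_intros) auto
  qed auto
  moreover have "blinfun_apply (integral (cbox a b) (D h)) w
      = \<beta> * tilt \<beta> a b (\<lambda>s. (w \<bullet> e_vec s) * \<phi> s) h" for w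
  proof -
    have "D h integrable_on cbox a b"
      unfolding D_def using \<phi>
      by (intro integrable_continuous continuous_intros
          bounded_linear.continuous_on[OF bounded_linear_blinfun_inner_left]) auto
    then have "blinfun_apply (integral (cbox a b) (D h)) w = integral (cbox a b) (\<lambda>t. blinfun_apply (D h t) w)"
      using integral_linear[of "D h" "cbox a b" "\<lambda>f. blinfun_apply f w"]
      by (simp add: blinfun.bounded_linear_left o_def)
    also have "\<dots> = integral (cbox a b) (\<lambda>s. \<beta> * (exp (\<beta> * (h \<bullet> e_vec s)) * ((w \<bullet> e_vec s) * \<phi> s)))"
      by (simp add: D_def blinfun.scaleR_left algebra_simps)
    finally show ?thesis unfolding tilt_def by simp
  qed
  ultimately have "(tilt \<beta> a b \<phi> has_derivative (\<lambda>w. \<beta> * tilt \<beta> a b (\<lambda>s. (w \<bullet> e_vec s) * \<phi> s) h)) (at h)"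
    by (auto simp: tilt_def[abs_def] elim!: has_derivative_eq_rhs)
  then show ?thesis by (rule has_derivative_at_withinI)
qed

lemma tilt_integrable:
  assumes "continuous_on {a..b} \<phi>"
  shows "(\<lambda>s. exp (\<beta> * (h \<bullet> e_vec s)) * \<phi> s) integrable_on {a..b}"
  using assms by (intro integrable_continuous_real continuous_intros)

lemma tilt_add:
  assumes "continuous_on {a..b} \<phi>" "continuous_on {a..b} \<psi>"
  shows "tilt \<beta> a b (\<lambda>s. \<phi> s + \<psi> s) h = tilt \<beta> a b \<phi> h + tilt \<beta> a b \<psi> h"
  unfolding tilt_def
  using integral_add[OF tilt_integrable[OF assms(1)] tilt_integrable[OF assms(2)], of \<beta> h \<beta> h]
  by (simp add: algebra_simps)

lemma tilt_cmult: "tilt \<beta> a b (\<lambda>s. c * \<phi> s) h = c * tilt \<beta> a b \<phi> h"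
  unfolding tilt_def by (simp add: mult.left_commute)

lemma tilt_const: "tilt \<beta> a b (\<lambda>s. c) h = c * tilt \<beta> a b (\<lambda>s. 1) h"
  using tilt_cmult[of \<beta> a b c "\<lambda>s. 1" h] by simp

lemma tilt_mono:
  assumes "continuous_on {a..b} \<phi>" "continuous_on {a..b} \<psi>"
    and "\<And>s. s \<in> {a..b} \<Longrightarrow> \<phi> s \<le> \<psi> s"
  shows "tilt \<beta> a b \<phi> h \<le> tilt \<beta> a b \<psi> h"
  unfolding tilt_def
  by (intro integral_le tilt_integrable assms mult_left_mono) auto

text \<open>By Cauchy-Schwarz and \<open>norm (e_vec s) = 1\<close> the integrand is bounded below
  by a positive constant.\<close>

lemma tilt_one_pos:
  assumes "a < b"
  shows "0 < tilt \<beta> a b (\<lambda>s. 1) h"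
proof -
  have "exp (- \<bar>\<beta>\<bar> * norm h) * (b - a) = integral {a..b} (\<lambda>s. exp (- \<bar>\<beta>\<bar> * norm h))"
    using assms by simp
  also have "\<dots> \<le> tilt \<beta> a b (\<lambda>s. 1) h"
    unfolding tilt_def
  proof (intro integral_le tilt_integrable)
    fix s
    have "\<bar>\<beta> * (h \<bullet> e_vec s)\<bar> \<le> \<bar>\<beta>\<bar> * norm h"
      using Cauchy_Schwarz_ineq2[of h "e_vec s"] by (simp add: abs_mult mult_left_mono)
    then show "exp (- \<bar>\<beta>\<bar> * norm h) \<le> exp (\<beta> * (h \<bullet> e_vec s)) * 1" by simp
  qed (auto intro: continuous_intros)
  finally show ?thesis using assms by (meson diff_gt_0_iff_gt exp_gt_zero less_le_trans mult_pos_pos)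
qed

lemma tilt_zero: "tilt \<beta> a b \<phi> 0 = integral {a..b} \<phi>"
  by (simp add: tilt_def)

definition tilt_mean :: "real \<Rightarrow> real \<Rightarrow> real \<Rightarrow> real \<times> real \<Rightarrow> real \<times> real" where
  "tilt_mean \<beta> a b h = (tilt \<beta> a b cos h / tilt \<beta> a b (\<lambda>s. 1) h, tilt \<beta> a b sin h / tilt \<beta> a b (\<lambda>s. 1) h)"

lemma inner_tilt_mean:
  "u \<bullet> tilt_mean \<beta> a b h = tilt \<beta> a b (\<lambda>s. u \<bullet> e_vec s) h / tilt \<beta> a b (\<lambda>s. 1) h"
proof -
  have "tilt \<beta> a b (\<lambda>s. u \<bullet> e_vec s) h = fst u * tilt \<beta> a b cos h + snd u * tilt \<beta> a b sin h"
    by (simp add: e_vec_def inner_prod_def tilt_add tilt_cmult continuous_intros)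
  then show ?thesis by (simp add: tilt_mean_def inner_prod_def add_divide_distrib)
qed

text \<open>The covariance of two linear forms under the normalised tilted measure; multiplied by
  \<open>\<beta>\<close> it is the derivative of the mean, by the quotient rule.\<close>

definition tilt_cov :: "real \<Rightarrow> real \<Rightarrow> real \<Rightarrow> real \<times> real \<Rightarrow> real \<times> real \<Rightarrow> real \<times> real \<Rightarrow> real" where
  "tilt_cov \<beta> a b h u w = tilt \<beta> a b (\<lambda>s. (u \<bullet> e_vec s) * (w \<bullet> e_vec s)) h / tilt \<beta> a b (\<lambda>s. 1) h
     - (u \<bullet> tilt_mean \<beta> a b h) * (w \<bullet> tilt_mean \<beta> a b h)"

lemma has_derivative_inner_tilt_mean:
  assumes "a < b"
  shows "((\<lambda>h. u \<bullet> tilt_mean \<beta> a b h) has_derivative (\<lambda>w. \<beta> * tilt_cov \<beta> a b h u w)) (at h within S)"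
proof -
  note pos = tilt_one_pos[OF assms, of \<beta> h]
  have "((\<lambda>h. tilt \<beta> a b (\<lambda>s. u \<bullet> e_vec s) h / tilt \<beta> a b (\<lambda>s. 1) h) has_derivative
     (\<lambda>w. \<beta> * tilt_cov \<beta> a b h u w)) (at h within S)"
    by (rule derivative_eq_intros has_derivative_tilt continuous_intros)+
      (use pos in \<open>auto simp: tilt_cov_def inner_tilt_mean field_simps\<close>)
  then show ?thesis by (simp add: inner_tilt_mean)
qed

text \<open>The two directions are kept apart because \<open>u\<close> will be aligned with an
  increment of the mean, and \<open>w\<close> with an increment of the field; equal norms give both
  forms the same bound. Centring at \<open>c\<close> leaves the covariance unchanged, and a variance
  is at most the second moment about \<open>c\<close>.\<close>

lemma tilt_cov_le:
  assumes "a < b" and r: "\<And>s. s \<in> {a..b} \<Longrightarrow> norm (e_vec s - c) \<le> r"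
    and uw: "norm u = norm w"
  shows "tilt_cov \<beta> a b h u w \<le> r\<^sup>2 * (norm w)\<^sup>2"
proof -
  define Z where "Z = tilt \<beta> a b (\<lambda>s. 1) h"
  define m where "m = w \<bullet> tilt_mean \<beta> a b h"
  have Z: "Z > 0" unfolding Z_def by (rule tilt_one_pos[OF assms(1)])
  have X: "(v \<bullet> e_vec s - v \<bullet> c)\<^sup>2 \<le> r\<^sup>2 * (norm v)\<^sup>2" if "s \<in> {a..b}" for v s
  proof -
    have "\<bar>v \<bullet> (e_vec s - c)\<bar> \<le> norm v * r"
      using Cauchy_Schwarz_ineq2[of v "e_vec s - c"] r[OF that]
      by (meson dual_order.trans mult_left_mono norm_ge_zero)
    then have "\<bar>v \<bullet> (e_vec s - c)\<bar>\<^sup>2 \<le> (norm v * r)\<^sup>2" by (intro power_mono) auto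
    then show ?thesis by (simp add: power_mult_distrib inner_diff_right mult.commute)
  qed
  have TU: "tilt \<beta> a b (\<lambda>s. u \<bullet> e_vec s) h = (u \<bullet> tilt_mean \<beta> a b h) * Z" for u
    using Z by (simp add: inner_tilt_mean Z_def)
  \<comment> \<open>With \<open>x\<close> and \<open>y\<close> the centred forms introduced below,
    the integrand is \<open>2 * x * (w \<bullet> e_vec s - m)\<close> plus \<open>y\<close> squared
    minus the square of \<open>w \<bullet> e_vec s - m\<close>. The squares of
    \<open>w \<bullet> e_vec s\<close> cancel, so only moments already named occur.\<close>
  have "2 * tilt \<beta> a b (\<lambda>s. (u \<bullet> e_vec s) * (w \<bullet> e_vec s)) h
      + (- 2 * m) * tilt \<beta> a b (\<lambda>s. u \<bullet> e_vec s) h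
      + (- 2 * (u \<bullet> c) + 2 * (m - w \<bullet> c)) * tilt \<beta> a b (\<lambda>s. w \<bullet> e_vec s) h
      + (2 * m * (u \<bullet> c) + (w \<bullet> c)\<^sup>2 - m\<^sup>2) * Z
      = tilt \<beta> a b (\<lambda>s. 2 * ((u \<bullet> e_vec s) * (w \<bullet> e_vec s)) + ((- 2 * m) * (u \<bullet> e_vec s)
          + ((- 2 * (u \<bullet> c) + 2 * (m - w \<bullet> c)) * (w \<bullet> e_vec s) + (2 * m * (u \<bullet> c) + (w \<bullet> c)\<^sup>2 - m\<^sup>2)))) h"
    unfolding Z_def
    by (subst tilt_add, (intro continuous_intros)+, subst tilt_cmult)+ (simp add: tilt_const[of _ _ _ "_ + _"] tilt_const[of _ _ _ "_ - _"])
  also have "\<dots> \<le> tilt \<beta> a b (\<lambda>s. 2 * (r\<^sup>2 * (norm w)\<^sup>2)) h"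
  proof (rule tilt_mono)
    fix s assume s: "s \<in> {a..b}"
    define x where "x = u \<bullet> e_vec s - u \<bullet> c"
    define y where "y = w \<bullet> e_vec s - w \<bullet> c"
    \<comment> \<open>\<open>2 x (y - E y) \<le> x\<^sup>2 + (y - E y)\<^sup>2\<close>, and \<open>E (x (y - E y))\<close> is the covariance.\<close>
    have "0 \<le> (x - (w \<bullet> e_vec s - m))\<^sup>2" by simp
    moreover have "x\<^sup>2 \<le> r\<^sup>2 * (norm w)\<^sup>2" "y\<^sup>2 \<le> r\<^sup>2 * (norm w)\<^sup>2"
      using X[OF s, of u] X[OF s, of w] uw by (simp_all add: x_def y_def)
    ultimately show "2 * ((u \<bullet> e_vec s) * (w \<bullet> e_vec s)) + ((- 2 * m) * (u \<bullet> e_vec s)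
          + ((- 2 * (u \<bullet> c) + 2 * (m - w \<bullet> c)) * (w \<bullet> e_vec s) + (2 * m * (u \<bullet> c) + (w \<bullet> c)\<^sup>2 - m\<^sup>2)))
        \<le> 2 * (r\<^sup>2 * (norm w)\<^sup>2)"
      unfolding x_def y_def by (simp add: power2_eq_square algebra_simps)
  qed (intro continuous_intros)+
  also have "\<dots> = 2 * (r\<^sup>2 * (norm w)\<^sup>2) * Z"
    unfolding Z_def by (rule tilt_const)
  finally have "2 * tilt \<beta> a b (\<lambda>s. (u \<bullet> e_vec s) * (w \<bullet> e_vec s)) h
     - 2 * (u \<bullet> tilt_mean \<beta> a b h) * m * Z + (m - w \<bullet> c)\<^sup>2 * Z \<le> 2 * (r\<^sup>2 * (norm w)\<^sup>2) * Z"
    unfolding TU by (simp add: m_def power2_eq_square algebra_simps)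
  moreover have "0 \<le> (m - w \<bullet> c)\<^sup>2 * Z" using Z by simp
  ultimately have "tilt \<beta> a b (\<lambda>s. (u \<bullet> e_vec s) * (w \<bullet> e_vec s)) h
     \<le> (r\<^sup>2 * (norm w)\<^sup>2 + (u \<bullet> tilt_mean \<beta> a b h) * m) * Z"
    by (simp add: algebra_simps)
  then have "tilt \<beta> a b (\<lambda>s. (u \<bullet> e_vec s) * (w \<bullet> e_vec s)) h / Z
     \<le> r\<^sup>2 * (norm w)\<^sup>2 + (u \<bullet> tilt_mean \<beta> a b h) * m"
    using Z by (simp add: pos_divide_le_eq)
  then show ?thesis by (simp add: tilt_cov_def Z_def m_def)
qed

text \<open>The mean value theorem on the segment from \<open>h\<close> to \<open>h + w\<close>.
  Pairing with a fixed \<open>u\<close> makes the function real-valued, and its derivative is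
  \<open>\<beta>\<close> times a covariance.\<close>

lemma tilt_mean_increment:
  assumes "a < b" "0 \<le> \<beta>" and r: "\<And>s. s \<in> {a..b} \<Longrightarrow> norm (e_vec s - c) \<le> r"
    and uw: "norm u = norm w"
  shows "u \<bullet> (tilt_mean \<beta> a b (h + w) - tilt_mean \<beta> a b h) \<le> \<beta> * r\<^sup>2 * (norm w)\<^sup>2"
proof -
  define f where "f = (\<lambda>t. u \<bullet> tilt_mean \<beta> a b (h + t *\<^sub>R w))"
  have f: "(f has_real_derivative \<beta> * tilt_cov \<beta> a b (h + t *\<^sub>R w) u w) (at t)" for t
  proof -
    have "((\<lambda>t. h + t *\<^sub>R w) has_derivative (\<lambda>t. t *\<^sub>R w)) (at t)"
      by (auto intro!: derivative_eq_intros)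
    from has_derivative_compose[OF this has_derivative_inner_tilt_mean[OF assms(1), of u \<beta> _ UNIV]]
    have "(f has_derivative (\<lambda>x. \<beta> * tilt_cov \<beta> a b (h + t *\<^sub>R w) u (x *\<^sub>R w))) (at t)"
      by (simp add: f_def o_def)
    moreover have "tilt_cov \<beta> a b k u (x *\<^sub>R w) = x * tilt_cov \<beta> a b k u w" for x k
    proof -
      have "tilt \<beta> a b (\<lambda>s. (u \<bullet> e_vec s) * ((x *\<^sub>R w) \<bullet> e_vec s)) k = tilt \<beta> a b (\<lambda>s. x * ((u \<bullet> e_vec s) * (w \<bullet> e_vec s))) k"
        by (simp add: mult.left_commute)
      then show ?thesis by (simp add: tilt_cov_def tilt_cmult algebra_simps)
    qed
    ultimately show ?thesis by (auto elim!: has_derivative_imp_has_field_derivative simp: mult.left_commute)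
  qed
  obtain z where "f 1 - f 0 = (1 - 0) * (\<beta> * tilt_cov \<beta> a b (h + z *\<^sub>R w) u w)"
    using MVT2[of 0 1 f "\<lambda>t. \<beta> * tilt_cov \<beta> a b (h + t *\<^sub>R w) u w"] f by auto
  also have "\<dots> \<le> \<beta> * (r\<^sup>2 * (norm w)\<^sup>2)"
    using tilt_cov_le[OF assms(1) r uw] assms(2) by (simp add: mult_left_mono)
  finally show ?thesis by (simp add: f_def inner_diff_right)
qed

section \<open>Geometry of a circular arc\<close>

lemma inner_e_vec_e_vec: "e_vec s \<bullet> e_vec t = cos (s - t)"
  by (simp add: e_vec_def inner_prod_def cos_diff)

text \<open>The disc has the chord of the arc as diameter. As \<open>d \<le> pi / 2\<close> makes
  \<open>cos d\<close> nonnegative, the distance from the chord midpoint is largest at the two ends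
  of the arc.\<close>

lemma e_vec_dist_chord_midpoint:
  assumes s: "\<bar>s - m\<bar> \<le> d" and d: "0 \<le> d" "d \<le> pi / 2"
  shows "norm (e_vec s - cos d *\<^sub>R e_vec m) \<le> sin d"
proof -
  have c: "cos d \<le> cos (s - m)"
    using cos_monotone_0_pi_le[of "\<bar>s - m\<bar>" d] s d pi_gt_zero by (simp add: abs_if split: if_splits)
       (metis cos_minus minus_diff_eq)+
  have "(norm (e_vec s - cos d *\<^sub>R e_vec m))\<^sup>2 = 1 + (cos d)\<^sup>2 - 2 * cos d * cos (s - m)"
  proof -
    have "e_vec t \<bullet> e_vec t = 1" for t by (simp add: inner_e_vec_e_vec)
    then show ?thesis
      unfolding power2_norm_eq_inner
      by (simp add: inner_diff_left inner_diff_right inner_e_vec_e_vec cos_diff power2_eq_square algebra_simps)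
  qed
  also have "\<dots> \<le> 1 + (cos d)\<^sup>2 - 2 * cos d * cos d"
    using c d by (simp add: mult_left_mono cos_ge_zero)
  also have "\<dots> = (sin d)\<^sup>2" by (use sin_cos_squared_add[of d] in \<open>simp add: power2_eq_square\<close>)
  finally show ?thesis
    by (rule power2_le_imp_le) (use d in \<open>auto intro: sin_ge_zero\<close>)
qed

section \<open>The constrained minimiser\<close>

locale sector_model =
  fixes \<beta> :: real and q :: nat
  assumes beta_pos: "0 < \<beta>" and q_ge_3: "3 \<le> q"
    and contractive: "\<beta> * (sin (pi / real q))\<^sup>2 < 1"
begin

abbreviation "lo k \<equiv> 2 * pi / real q * (real k - 1)"
abbreviation "hi k \<equiv> 2 * pi / real q * real k"
abbreviation "circle \<equiv> {0..<2 * pi}"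

definition \<kappa> where "\<kappa> = \<beta> * (sin (pi / real q))\<^sup>2"
definition sector_tilt where "sector_tilt k = tilt \<beta> (lo k) (hi k)"
definition Z where "Z k = sector_tilt k (\<lambda>s. 1)"
definition mean where "mean k = tilt_mean \<beta> (lo k) (hi k)"
definition total_mean where "total_mean p h = (\<Sum>k=1..q. p k *\<^sub>R mean k h)"

section \<open>The mean with prescribed sector weights as a contraction of the plane\<close>

lemma kappa: "0 \<le> \<kappa>" "\<kappa> < 1"
  using beta_pos contractive by (auto simp: \<kappa>_def)

lemma q_pos: "0 < real q" using q_ge_3 by simp

lemma lo_less_hi: "lo k < hi k"
  using q_pos by (simp add: field_simps)

lemma Z_pos: "0 < Z k h"
  unfolding Z_def sector_tilt_def by (rule tilt_one_pos[OF lo_less_hi])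

lemma mean_increment:
  assumes "norm u = norm w"
  shows "u \<bullet> (mean k (h + w) - mean k h) \<le> \<kappa> * (norm w)\<^sup>2"
  unfolding mean_def \<kappa>_def
proof (rule tilt_mean_increment[OF lo_less_hi _ _ assms])
  show "0 \<le> \<beta>" using beta_pos by simp
  fix s assume s: "s \<in> {lo k..hi k}"
  show "norm (e_vec s - cos (pi / real q) *\<^sub>R e_vec ((lo k + hi k) / 2)) \<le> sin (pi / real q)"
  proof (rule e_vec_dist_chord_midpoint)
    have mid: "\<bar>x - (l + u) / 2\<bar> \<le> d" if "x \<in> {l..u}" "u - l = 2 * d" for x l u d :: real
      using that by (auto simp: abs_le_iff field_simps)
    show "\<bar>s - (lo k + hi k) / 2\<bar> \<le> pi / real q"
      by (rule mid[OF s]) (use q_pos in \<open>simp add: field_simps\<close>)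
    show "pi / real q \<le> pi / 2" using q_ge_3 by (intro divide_left_mono) auto
  qed simp
qed

lemma total_mean_lipschitz:
  assumes p: "\<forall>k\<in>{1..q}. 0 \<le> p k" "(\<Sum>k=1..q. p k) = 1"
  shows "norm (total_mean p y - total_mean p x) \<le> \<kappa> * norm (y - x)"
proof (cases "total_mean p y = total_mean p x")
  case True then show ?thesis using kappa by simp
next
  case False
  define w where "w = y - x"
  define v where "v = total_mean p y - total_mean p x"
  \<comment> \<open>The direction of the increment of the mean, rescaled to the length of
    \<open>w\<close> so that \<open>mean_increment\<close> applies in every sector; pairing with
    \<open>u\<close> recovers the norm of the increment.\<close>
  define u where "u = (norm w / norm v) *\<^sub>R v"
  have v: "norm v > 0" using False by (simp add: v_def)
  have w: "norm w > 0" using False by (auto simp: w_def)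
  have "norm w * norm v = u \<bullet> v"
    using v by (simp add: u_def dot_square_norm power2_eq_square)
  also have "\<dots> = (\<Sum>k=1..q. p k * (u \<bullet> (mean k (x + w) - mean k x)))"
    by (simp add: v_def w_def total_mean_def inner_diff_right inner_sum_right sum_subtractf algebra_simps)
  also have "\<dots> \<le> (\<Sum>k=1..q. p k * (\<kappa> * (norm w)\<^sup>2))"
    using v by (intro sum_mono mult_left_mono mean_increment) (auto simp: u_def p)
  also have "\<dots> = norm w * (\<kappa> * norm w)"
    using p(2) by (simp flip: sum_distrib_right add: power2_eq_square)
  finally show ?thesis using w by (simp add: v_def w_def)
qed

lemma ex1_fixed_point:
  assumes p: "\<forall>k\<in>{1..q}. 0 \<le> p k" "(\<Sum>k=1..q. p k) = 1"
  shows "\<exists>!h. total_mean p h = h"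
  using kappa total_mean_lipschitz[OF p]
  by (intro banach_fix_type[of \<kappa>]) (auto simp: dist_norm)

section \<open>Sectors, and integrals over the circle split along them\<close>

lemma sector_measurable [measurable]: "sector q k \<in> sets borel"
  by (simp add: sector_def)

lemma sector_subset_circle:
  assumes "k \<in> {1..q}"
  shows "sector q k \<subseteq> circle"
proof
  fix s assume s: "s \<in> sector q k"
  have "0 \<le> 2 * pi / real q * (real k - 1)" using assms by simp
  moreover have "2 * pi / real q * real k \<le> 2 * pi" using assms q_pos by (simp add: field_simps)
  ultimately show "s \<in> circle" using s by (simp add: sector_def)
qed

lemma sector_disjoint:
  assumes "s \<in> sector q k" "s \<in> sector q j"
  shows "k = j"
proof -
  define x where "x = s * real q / (2 * pi)"
  have "real i - 1 \<le> x \<and> x < real i" if "s \<in> sector q i" for i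
    using that q_pos by (auto simp: sector_def x_def field_simps)
  from this[OF assms(1)] this[OF assms(2)] show ?thesis by linarith
qed

lemma circle_covered:
  assumes "s \<in> circle"
  obtains k where "k \<in> {1..q}" "s \<in> sector q k"
proof -
  define x where "x = s * real q / (2 * pi)"
  have x: "0 \<le> x" "x < real q" using assms q_pos by (auto simp: x_def field_simps)
  define k where "k = nat \<lfloor>x\<rfloor> + 1"
  have k: "real k - 1 \<le> x" "x < real k" using x by (auto simp: k_def) linarith
  have "k \<in> {1..q}" using x by (auto simp: k_def) linarith
  moreover have "s \<in> sector q k"
    using k q_pos by (auto simp: sector_def x_def field_simps)
  ultimately show thesis by (rule that)
qed

lemma circle_integrable:
  assumes "continuous_on UNIV (\<phi> :: real \<Rightarrow> real)"
  shows "set_integrable lborel circle \<phi>"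
  by (rule set_integrable_subset[OF borel_integrable_atLeastAtMost'[of 0 "2 * pi"]])
     (auto intro: continuous_on_subset[OF assms])

text \<open>Passes from the Lebesgue integral over the half-open sector to the Henstock-Kurzweil
  integral over the closed arc, where differentiation under the integral is done. The domains differ
  by one endpoint.\<close>

lemma sector_integral:
  assumes "continuous_on UNIV \<phi>"
  shows "(LINT s:sector q k|lborel. exp (\<beta> * (h \<bullet> e_vec s)) * \<phi> s) = sector_tilt k \<phi> h"
proof -
  have *: "set_integrable lborel {lo k..hi k} (\<lambda>s. exp (\<beta> * (h \<bullet> e_vec s)) * \<phi> s)"
    by (intro borel_integrable_atLeastAtMost' continuous_intros continuous_on_subset[OF assms]) auto
  have "set_integrable lborel (sector q k) (\<lambda>s. exp (\<beta> * (h \<bullet> e_vec s)) * \<phi> s)"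
    by (rule set_integrable_subset[OF *]) (auto simp: sector_def)
  then have "(LINT s:sector q k|lborel. exp (\<beta> * (h \<bullet> e_vec s)) * \<phi> s)
      = integral (sector q k) (\<lambda>s. exp (\<beta> * (h \<bullet> e_vec s)) * \<phi> s)"
    by (rule set_borel_integral_eq_integral)
  also have "\<dots> = sector_tilt k \<phi> h"
    unfolding sector_tilt_def tilt_def sector_def
  proof (rule integral_subset_negligible)
    have "{lo k..hi k} - {lo k..<hi k} \<subseteq> {hi k}" by auto
    then show "negligible ({lo k..hi k} - {lo k..<hi k})"
      using negligible_subset negligible_sing by blast
  qed auto
  finally show ?thesis .
qed

definition step :: "(nat \<Rightarrow> real) \<Rightarrow> real \<Rightarrow> real" where
  "step c s = (\<Sum>k=1..q. indicator (sector q k) s * c k)"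

lemma step_eq:
  assumes "k \<in> {1..q}" "s \<in> sector q k"
  shows "step c s = c k"
proof -
  have "step c s = (\<Sum>j=1..q. if j = k then c k else 0)"
    unfolding step_def
  proof (rule sum.cong)
    fix j assume "j \<in> {1..q}"
    show "indicator (sector q j) s * c j = (if j = k then c k else 0)"
      using assms(2) sector_disjoint[OF assms(2), of j] by (cases "j = k") (auto simp: indicator_def)
  qed simp
  then show ?thesis using assms by simp
qed

lemma step_measurable [measurable]: "step c \<in> borel_measurable lborel"
  unfolding step_def by measurable

text \<open>Against a function constant on sectors, \<open>g\<close> enters only through its sector
  masses, which are the same for all competitors on a fibre.\<close>

lemma step_integral:
  assumes g: "set_integrable lborel circle g"
  shows "set_integrable lborel circle (\<lambda>s. step c s * g s)" (is ?int)
    and "(LINT s:circle|lborel. step c s * g s) = (\<Sum>k=1..q. c k * (LINT s:sector q k|lborel. g s))" (is ?eq)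
proof -
  have sub: "set_integrable lborel (sector q k) g" if "k \<in> {1..q}" for k
    by (rule set_integrable_subset[OF g _ sector_subset_circle[OF that]]) simp
  have *: "indicator circle s *\<^sub>R (step c s * g s) = (\<Sum>k=1..q. c k * (indicator (sector q k) s *\<^sub>R g s))" for s
  proof -
    have "indicator circle s * (indicator (sector q k) s * c k * g s) = c k * (indicator (sector q k) s * g s)"
      if "k \<in> {1..q}" for k
      using sector_subset_circle[OF that] by (auto simp: indicator_def)
    then show ?thesis
      unfolding step_def real_scaleR_def sum_distrib_right sum_distrib_left
      by (intro sum.cong refl)
  qed
  show ?int ?eq
    unfolding set_integrable_def set_lebesgue_integral_def *
    using sub by (auto simp: set_integrable_def)
qed

lemma bounded_mult_integrable:
  fixes g \<phi> :: "real \<Rightarrow> real"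
  assumes g: "set_integrable lborel circle g" "g \<in> borel_measurable lborel"
    and \<phi>: "\<phi> \<in> borel_measurable lborel" "\<And>s. \<bar>\<phi> s\<bar> \<le> 1"
  shows "set_integrable lborel circle (\<lambda>s. \<phi> s * g s)"
proof (rule set_integrable_bound[OF g(1)])
  show "set_borel_measurable lborel circle (\<lambda>s. \<phi> s * g s)"
    unfolding set_borel_measurable_def using g(2) \<phi>(1) by measurable
  show "AE x in lborel. x \<in> circle \<longrightarrow> norm (\<phi> x * g x) \<le> norm (g x)"
    using \<phi>(2) by (auto simp: abs_mult intro!: mult_left_le_one_le)
qed

text \<open>The shape that stationarity suggests for a constrained minimiser: its logarithm is
  linear in \<open>e_vec s\<close> up to one constant per sector, and the constants are fixed by the
  sector masses \<open>p k\<close>.\<close>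

definition gibbs :: "(nat \<Rightarrow> real) \<Rightarrow> real \<times> real \<Rightarrow> real \<Rightarrow> real" where
  "gibbs p h s = step (\<lambda>k. p k / Z k h) s * exp (\<beta> * (h \<bullet> e_vec s))"

lemma gibbs_integral:
  assumes \<phi>: "continuous_on UNIV \<phi>"
  shows "set_integrable lborel circle (\<lambda>s. \<phi> s * gibbs p h s)"
    and "(LINT s:circle|lborel. \<phi> s * gibbs p h s) = (\<Sum>k=1..q. p k / Z k h * sector_tilt k \<phi> h)"
proof -
  have "continuous_on UNIV (\<lambda>s. exp (\<beta> * (h \<bullet> e_vec s)) * \<phi> s)"
    by (intro continuous_intros \<phi>)
  note c = circle_integrable[OF this]
  have eq: "(\<lambda>s. \<phi> s * gibbs p h s) = (\<lambda>s. step (\<lambda>k. p k / Z k h) s * (exp (\<beta> * (h \<bullet> e_vec s)) * \<phi> s))"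
    by (simp add: gibbs_def fun_eq_iff)
  show "set_integrable lborel circle (\<lambda>s. \<phi> s * gibbs p h s)"
    "(LINT s:circle|lborel. \<phi> s * gibbs p h s) = (\<Sum>k=1..q. p k / Z k h * sector_tilt k \<phi> h)"
    unfolding eq using step_integral[OF c] by (simp_all add: sector_integral[OF \<phi>])
qed

lemma gibbs_measurable [measurable]: "gibbs p h \<in> borel_measurable lborel"
proof -
  have "(\<lambda>s. exp (\<beta> * (h \<bullet> e_vec s))) \<in> borel_measurable lborel"
    by (simp add: borel_measurable_continuous_onI continuous_intros)
  then show ?thesis unfolding gibbs_def[abs_def] by measurable
qed

lemma magn_gibbs: "magn (gibbs p h) = total_mean p h"
  unfolding magn_def
  by (simp add: gibbs_integral continuous_intros total_mean_def mean_def tilt_mean_def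
      prod_eq_iff fst_sum snd_sum sector_tilt_def Z_def)

lemma Tproj_gibbs:
  assumes "k \<in> {1..q}"
  shows "Tproj q (gibbs p h) k = p k"
proof -
  have "Tproj q (gibbs p h) k = (LINT s:sector q k|lborel. p k / Z k h * (exp (\<beta> * (h \<bullet> e_vec s)) * 1))"
    unfolding Tproj_def gibbs_def
    by (rule set_lebesgue_integral_cong) (auto simp: step_eq[OF assms])
  also have "\<dots> = p k / Z k h * Z k h"
    unfolding Z_def
    by (subst set_integral_mult_right, subst sector_integral) (auto intro: continuous_intros)
  finally show ?thesis using Z_pos[of k h] by simp
qed

lemma gibbs_pos:
  assumes p: "\<forall>k\<in>{1..q}. 0 < p k" and s: "s \<in> circle"
  shows "0 < gibbs p h s"
    and "ln (gibbs p h s) = step (\<lambda>k. ln (p k / Z k h)) s + \<beta> * (h \<bullet> e_vec s)"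
proof -
  obtain k where k: "k \<in> {1..q}" "s \<in> sector q k" using circle_covered[OF s] .
  have "0 < p k / Z k h" using bspec[OF p k(1)] Z_pos[of k h] by simp
  then show "0 < gibbs p h s"
    "ln (gibbs p h s) = step (\<lambda>k. ln (p k / Z k h)) s + \<beta> * (h \<bullet> e_vec s)"
    unfolding gibbs_def step_eq[OF k] by (simp_all only: mult_pos_pos exp_gt_zero ln_mult_pos ln_exp)
qed

text \<open>The logarithm of a Gibbs density is constant on sectors plus a linear form in
  \<open>e_vec s\<close>. Its integral against \<open>g\<close> therefore depends only on the sector
  masses and on \<open>magn g\<close>.\<close>

lemma cross_entropy_gibbs:
  assumes p: "\<forall>k\<in>{1..q}. 0 < p k"
    and g: "g \<in> borel_measurable lborel" "set_integrable lborel circle g"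
    and T: "\<forall>k\<in>{1..q}. Tproj q g k = p k"
  shows "set_integrable lborel circle (\<lambda>s. g s * ln (gibbs p y s))"
    and "(LINT s:circle|lborel. g s * ln (gibbs p y s))
      = (\<Sum>k=1..q. p k * ln (p k / Z k y)) + \<beta> * (y \<bullet> magn g)"
proof -
  have cos: "set_integrable lborel circle (\<lambda>s. cos s * g s)"
    and sin: "set_integrable lborel circle (\<lambda>s. sin s * g s)"
    by (auto intro!: bounded_mult_integrable[OF g(2,1)])
  have eq: "g s * ln (gibbs p y s) = step (\<lambda>k. ln (p k / Z k y)) s * g s
      + (\<beta> * fst y * (cos s * g s) + \<beta> * snd y * (sin s * g s))" if "s \<in> circle" for s
    unfolding gibbs_pos(2)[OF p that] by (simp add: e_vec_def inner_prod_def algebra_simps)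
  note st = step_integral[OF g(2), of "\<lambda>k. ln (p k / Z k y)"]
  have i: "set_integrable lborel circle (\<lambda>s. \<beta> * fst y * (cos s * g s))"
    "set_integrable lborel circle (\<lambda>s. \<beta> * snd y * (sin s * g s))"
    using cos sin by auto
  have e: "(LINT s:circle|lborel. g s * ln (gibbs p y s)) = (LINT s:circle|lborel. step (\<lambda>k. ln (p k / Z k y)) s * g s
      + (\<beta> * fst y * (cos s * g s) + \<beta> * snd y * (sin s * g s)))"
    by (rule set_lebesgue_integral_cong) (auto simp: eq)
  have "set_integrable lborel circle (\<lambda>s. g s * ln (gibbs p y s)) =
    set_integrable lborel circle (\<lambda>s. step (\<lambda>k. ln (p k / Z k y)) s * g s
      + (\<beta> * fst y * (cos s * g s) + \<beta> * snd y * (sin s * g s)))"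
    by (rule set_integrable_cong) (auto simp: eq)
  then show "set_integrable lborel circle (\<lambda>s. g s * ln (gibbs p y s))"
    using set_integral_add(1)[OF st(1) set_integral_add(1)[OF i]] by simp
  show "(LINT s:circle|lborel. g s * ln (gibbs p y s))
      = (\<Sum>k=1..q. p k * ln (p k / Z k y)) + \<beta> * (y \<bullet> magn g)"
    unfolding e set_integral_add(2)[OF st(1) set_integral_add(1)[OF i]] set_integral_add(2)[OF i] st(2)
      set_integral_mult_right
    using T by (simp add: Tproj_def magn_def inner_prod_def algebra_simps)
qed

section \<open>Gibbs' inequality and the constrained minimum\<close>

lemma Tproj_sum:
  assumes "set_integrable lborel circle g"
  shows "(LINT s:circle|lborel. g s) = (\<Sum>k=1..q. Tproj q g k)"
proof -
  have "(LINT s:circle|lborel. g s) = (LINT s:circle|lborel. step (\<lambda>k. 1) s * g s)"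
  proof (rule set_lebesgue_integral_cong)
    have "step (\<lambda>k. 1) s = 1" if s: "s \<in> circle" for s
    proof -
      obtain k where "k \<in> {1..q}" "s \<in> sector q k" using circle_covered[OF s] .
      then show ?thesis by (rule step_eq)
    qed
    then show "\<forall>s. s \<in> circle \<longrightarrow> g s = step (\<lambda>k. 1) s * g s" by simp
  qed simp
  then show ?thesis unfolding step_integral(2)[OF assms] by (simp add: Tproj_def)
qed

text \<open>The quadratic term is the energy \<open>- \<beta> / 2\<close> plus the cross-entropy
  contribution \<open>\<beta>\<close>, each times the squared norm of \<open>y\<close>. The gradient
  is \<open>\<beta> *\<^sub>R (y - total_mean p y)\<close>.\<close>

definition J where "J p y = \<beta> / 2 * (norm y)\<^sup>2 - (\<Sum>k=1..q. p k * ln (Z k y))"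

lemma ln_ratio_sum:
  assumes p: "\<forall>k\<in>{1..q}. 0 < p k"
  shows "(\<Sum>k=1..q. p k * ln (p k / Z k y)) = (\<Sum>k=1..q. p k * ln (p k)) - (\<Sum>k=1..q. p k * ln (Z k y))"
  unfolding sum_subtractf[symmetric]
proof (rule sum.cong)
  fix k assume "k \<in> {1..q}"
  then show "p k * ln (p k / Z k y) = p k * ln (p k) - p k * ln (Z k y)"
    using p Z_pos[of k y] by (simp add: ln_div algebra_simps)
qed simp

lemma Phi_eq: "Phi \<beta> f = - \<beta> / 2 * (norm (magn f))\<^sup>2"
  by (simp add: Phi_def norm_prod_def)

lemma free_energy_ge_J:
  assumes p: "\<forall>k\<in>{1..q}. 0 < p k" "(\<Sum>k=1..q. p k) = 1"
    and g: "admissible_density g" and T: "\<forall>k\<in>{1..q}. Tproj q g k = p k"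
  shows "J p (magn g) + (\<Sum>k=1..q. p k * ln (p k)) \<le> free_energy \<beta> g"
proof -
  define y where "y = magn g"
  have g': "g \<in> borel_measurable lborel" "set_integrable lborel circle g"
    "set_integrable lborel circle (\<lambda>s. g s * ln (g s))" "\<And>s. s \<in> circle \<Longrightarrow> 0 \<le> g s"
    using g by (auto simp: admissible_density_def)
  note cross = cross_entropy_gibbs[OF p(1) g'(1,2) T, of y]
  have gi: "set_integrable lborel circle (gibbs p y)"
    using gibbs_integral(1)[of "\<lambda>s. 1" p y] by simp
  have "1 = (LINT s:circle|lborel. gibbs p y s)"
    unfolding Tproj_sum[OF gi] using p(2) by (simp add: Tproj_gibbs)
  moreover have "1 = (LINT s:circle|lborel. g s)"
    unfolding Tproj_sum[OF g'(2)] using p(2) T by simp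
  \<comment> \<open>Both densities have mass one, so adding their difference leaves the integral
    unchanged and makes the inequality with \<open>g s * ln (g s)\<close> hold pointwise.\<close>
  ultimately have "(LINT s:circle|lborel. g s * ln (gibbs p y s))
     = (LINT s:circle|lborel. g s * ln (gibbs p y s) + (g s - gibbs p y s))"
    using cross(1) g'(2) gi by (simp add: set_integral_add(2) set_integral_diff)
  also have "\<dots> \<le> rel_entropy g"
    unfolding rel_entropy_def
  proof (rule set_integral_mono)
    show "set_integrable lborel circle (\<lambda>s. g s * ln (gibbs p y s) + (g s - gibbs p y s))"
      using cross(1) g'(2) gi by (intro set_integral_add set_integral_diff)
    fix s assume s: "s \<in> circle"
    define w where "w = gibbs p y s"
    have w: "0 < w" unfolding w_def using gibbs_pos(1)[OF p(1) s] .
    show "g s * ln (gibbs p y s) + (g s - gibbs p y s) \<le> g s * ln (g s)"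
    proof (cases "g s = 0")
      \<comment> \<open>Where \<open>g\<close> vanishes both logarithmic terms are zero, and
        \<open>- w\<close> remains on the left.\<close>
      case True then show ?thesis using w by (simp add: w_def)
    next
      case False
      then have gs: "0 < g s" using g'(4)[OF s] by simp
      have "ln (w / g s) \<le> w / g s - 1" using gs w by (intro ln_le_minus_one) simp
      then have "g s * ln (w / g s) \<le> g s * (w / g s - 1)" using gs by (intro mult_left_mono) auto
      then show ?thesis using gs w by (simp add: w_def ln_div algebra_simps)
    qed
  qed (fact g')
  finally show ?thesis
    unfolding cross(2) ln_ratio_sum[OF p(1)] free_energy_def Phi_eq J_def
    by (simp add: y_def dot_square_norm)
qed

lemma gibbs_admissible:
  assumes p: "\<forall>k\<in>{1..q}. 0 < p k"
  shows "admissible_density (gibbs p h)"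
    and "rel_entropy (gibbs p h) = (\<Sum>k=1..q. p k * ln (p k / Z k h)) + \<beta> * (h \<bullet> total_mean p h)"
proof -
  have gi: "set_integrable lborel circle (gibbs p h)"
    using gibbs_integral(1)[of "\<lambda>s. 1" p h] by simp
  have "\<forall>k\<in>{1..q}. Tproj q (gibbs p h) k = p k" by (simp add: Tproj_gibbs)
  note c = cross_entropy_gibbs[OF p gibbs_measurable gi this, of h]
  show "admissible_density (gibbs p h)"
    using gi c(1) by (auto simp: admissible_density_def intro!: less_imp_le gibbs_pos(1)[OF p])
  show "rel_entropy (gibbs p h) = (\<Sum>k=1..q. p k * ln (p k / Z k h)) + \<beta> * (h \<bullet> total_mean p h)"
    unfolding rel_entropy_def c(2) by (simp add: magn_gibbs)
qed

text \<open>On the segment from \<open>h\<close> to \<open>y\<close> the slope of \<open>J p\<close>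
  at \<open>t\<close> is \<open>\<beta>\<close> times \<open>t\<close> times the squared norm of
  \<open>w\<close>, minus \<open>\<beta>\<close> times the pairing of \<open>w\<close> with the
  change of \<open>total_mean p\<close> since \<open>h\<close>. The contraction property makes the
  first term win. The logarithmic derivative of \<open>Z k\<close> supplies the means.\<close>

lemma J_less:
  assumes p: "\<forall>k\<in>{1..q}. 0 \<le> p k" "(\<Sum>k=1..q. p k) = 1"
    and h: "total_mean p h = h" and ne: "y \<noteq> h"
  shows "J p h < J p y"
proof -
  define w where "w = y - h"
  have w: "0 < norm w" using ne by (simp add: w_def)
  define f where "f = (\<lambda>t. J p (h + t *\<^sub>R w))"
  define f' where "f' = (\<lambda>t. \<beta> * (w \<bullet> (h + t *\<^sub>R w) - w \<bullet> total_mean p (h + t *\<^sub>R w)))"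
  have line: "((\<lambda>t. h + t *\<^sub>R w) has_derivative (\<lambda>t. t *\<^sub>R w)) (at t)" for t
    by (auto intro!: derivative_eq_intros)
  have Zd: "((\<lambda>t. Z k (h + t *\<^sub>R w)) has_real_derivative
      \<beta> * (w \<bullet> mean k (h + t *\<^sub>R w)) * Z k (h + t *\<^sub>R w)) (at t)" for k t
  proof -
    have "((\<lambda>t. Z k (h + t *\<^sub>R w)) has_derivative
      (\<lambda>x. \<beta> * tilt \<beta> (lo k) (hi k) (\<lambda>s. ((x *\<^sub>R w) \<bullet> e_vec s) * 1) (h + t *\<^sub>R w))) (at t)"
      using has_derivative_compose[OF line has_derivative_tilt[of "lo k" "hi k" "\<lambda>s. 1" \<beta> _ UNIV]]
      by (simp add: Z_def sector_tilt_def o_def)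
    moreover have "tilt \<beta> (lo k) (hi k) (\<lambda>s. ((x *\<^sub>R w) \<bullet> e_vec s) * 1) (h + t *\<^sub>R w)
        = x * ((w \<bullet> mean k (h + t *\<^sub>R w)) * Z k (h + t *\<^sub>R w))" for x
      using Z_pos[of k "h + t *\<^sub>R w"]
      by (simp add: inner_tilt_mean mean_def Z_def sector_tilt_def tilt_cmult)
    ultimately show ?thesis
      by (auto elim!: has_derivative_imp_has_field_derivative simp: algebra_simps)
  qed
  have f: "(f has_real_derivative f' t) (at t)" for t
  proof -
    have "((\<lambda>t. \<beta> / 2 * ((h + t *\<^sub>R w) \<bullet> (h + t *\<^sub>R w)) - (\<Sum>k=1..q. p k * ln (Z k (h + t *\<^sub>R w))))
      has_real_derivative \<beta> * (w \<bullet> (h + t *\<^sub>R w)) - (\<Sum>k=1..q. p k * (\<beta> * (w \<bullet> mean k (h + t *\<^sub>R w))))) (at t)"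
    proof (intro DERIV_diff DERIV_sum DERIV_cmult)
      have "(\<lambda>t. \<beta> / 2 * ((h + t *\<^sub>R w) \<bullet> (h + t *\<^sub>R w))) =
         (\<lambda>t. \<beta> / 2 * (h \<bullet> h + 2 * t * (h \<bullet> w) + t\<^sup>2 * (w \<bullet> w)))"
        by (simp add: inner_add_left inner_add_right power2_eq_square algebra_simps inner_commute fun_eq_iff)
      then show "((\<lambda>t. \<beta> / 2 * ((h + t *\<^sub>R w) \<bullet> (h + t *\<^sub>R w))) has_real_derivative \<beta> * (w \<bullet> (h + t *\<^sub>R w))) (at t)"
        by (auto intro!: derivative_eq_intros simp: inner_add_right inner_commute algebra_simps)
      fix k
      show "((\<lambda>t. ln (Z k (h + t *\<^sub>R w))) has_real_derivative \<beta> * (w \<bullet> mean k (h + t *\<^sub>R w))) (at t)"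
        using Z_pos[of k "h + t *\<^sub>R w"] by (auto intro!: derivative_eq_intros Zd)
    qed
    then show ?thesis
      by (simp add: f_def J_def dot_square_norm f'_def total_mean_def inner_sum_right
          right_diff_distrib sum_distrib_left mult.left_commute)
  qed
  obtain z where z: "0 < z" "z < 1" "f 1 - f 0 = (1 - 0) * f' z"
    using MVT2[of 0 1 f f'] f by auto
  have "w \<bullet> (total_mean p (h + z *\<^sub>R w) - total_mean p h)
      \<le> norm w * norm (total_mean p (h + z *\<^sub>R w) - total_mean p h)"
    by (rule norm_cauchy_schwarz)
  also have "\<dots> \<le> norm w * (\<kappa> * norm (h + z *\<^sub>R w - h))"
    by (intro mult_left_mono total_mean_lipschitz p) auto
  also have "\<dots> = \<kappa> * (z * (norm w)\<^sup>2)" using z by (simp add: power2_eq_square)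
  also have "\<dots> < 1 * (z * (norm w)\<^sup>2)"
    using kappa z w by (intro mult_strict_right_mono) auto
  finally have "0 < f' z"
    using beta_pos unfolding f'_def h by (simp add: inner_diff_right inner_add_right dot_square_norm)
  then show ?thesis using z(3) by (simp add: f_def w_def)
qed

text \<open>At a fixed point the lower bound is attained by the Gibbs density, whose magnetisation
  is \<open>h\<close>. Any other minimiser has the same free energy, so strictness of
  \<open>J_less\<close> forces its magnetisation to be \<open>h\<close>; this uniqueness is what
  \<open>THE\<close> asks for, densities being determined only almost everywhere.\<close>

lemma M_beta_eq:
  assumes p: "\<forall>k\<in>{1..q}. 0 < p k" "(\<Sum>k=1..q. p k) = 1"
    and h: "total_mean p h = h"
  shows "M_beta \<beta> q p = h"
proof -
  have p0: "\<forall>k\<in>{1..q}. 0 \<le> p k" using p(1) by (auto intro: less_imp_le)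
  define E where "E = (\<Sum>k=1..q. p k * ln (p k))"
  have FE: "free_energy \<beta> (gibbs p h) = J p h + E"
    unfolding free_energy_def Phi_eq magn_gibbs gibbs_admissible(2)[OF p(1)] h J_def ln_ratio_sum[OF p(1)] E_def
    by (simp add: dot_square_norm)
  have ge: "J p (magn g) + E \<le> free_energy \<beta> g"
    if "admissible_density g" "\<forall>k\<in>{1..q}. Tproj q g k = p k" for g
    unfolding E_def using that by (intro free_energy_ge_J p) auto
  have J: "J p h \<le> J p y" for y
    using J_less[OF p0 p(2) h, of y] by (cases "y = h") auto
  have min: "is_constrained_minimizer \<beta> q p (gibbs p h)"
    unfolding is_constrained_minimizer_def
  proof (intro conjI allI impI ballI)
    fix g assume "admissible_density g \<and> (\<forall>k\<in>{1..q}. Tproj q g k = p k)"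
    then show "free_energy \<beta> (gibbs p h) \<le> free_energy \<beta> g"
      using ge[of g] J[of "magn g"] FE by linarith
  qed (use gibbs_admissible(1)[OF p(1)] in \<open>auto simp: Tproj_gibbs\<close>)
  show ?thesis
    unfolding M_beta_def
  proof (rule the_equality)
    show "\<exists>f. is_constrained_minimizer \<beta> q p f \<and> h = magn f"
      using min by (intro exI[of _ "gibbs p h"]) (simp add: magn_gibbs h)
    fix m assume "\<exists>f. is_constrained_minimizer \<beta> q p f \<and> m = magn f"
    then obtain f where f: "is_constrained_minimizer \<beta> q p f" "m = magn f" by blast
    then have "free_energy \<beta> f \<le> free_energy \<beta> (gibbs p h)"
      using min by (auto simp: is_constrained_minimizer_def)
    moreover have "J p m + E \<le> free_energy \<beta> f"
      using ge f by (auto simp: is_constrained_minimizer_def)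
    ultimately show "m = h"
      using J_less[OF p0 p(2) h, of m] FE by force
  qed
qed

end

section \<open>The linearisation at the equidistribution\<close>

text \<open>Orthogonality of the characters of the cyclic group of order \<open>q\<close>, by a
  geometric sum. Integer frequencies cover differences of modes.\<close>

lemma sum_cis_multiples:
  fixes m :: int
  assumes "0 < q"
  shows "(\<Sum>k=1..q. cis (2 * pi * real_of_int m * real k / real q)) = (if int q dvd m then of_nat q else 0)"
proof -
  define z where "z = cis (2 * pi * real_of_int m / real q)"
  have pow: "cis (2 * pi * real_of_int m * real k / real q) = z ^ k" for k
    by (simp add: z_def DeMoivre algebra_simps)
  have zq: "z ^ q = 1"
    using assms cis_multiple_2pi[of "real_of_int m"] by (simp add: z_def DeMoivre)
  show ?thesis
  proof (cases "int q dvd m")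
    case True
    then obtain r where "m = int q * r" by blast
    then have "z = 1" using assms cis_multiple_2pi[of "real_of_int r"] by (simp add: z_def algebra_simps)
    then show ?thesis unfolding pow using True by simp
  next
    case False
    have "z \<noteq> 1"
    proof
      assume "z = 1"
      then have "cos (2 * pi * real_of_int m / real q) = 1" by (simp add: z_def complex_eq_iff)
      then obtain n :: int where "2 * pi * real_of_int m / real q = real_of_int n * 2 * pi"
        unfolding cos_one_2pi_int by blast
      then have "real_of_int m = real_of_int (n * int q)" using assms by (simp add: field_simps)
      then have "m = n * int q" by linarith
      with False show False by simp
    qed
    moreover have "(\<Sum>k=1..q. z ^ k) = z * (\<Sum>k<q. z ^ k)"
      by (simp add: sum_distrib_left sum.atLeast1_atMost_eq)
    ultimately show ?thesis unfolding pow using False zq by (simp add: geometric_sum)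
  qed
qed

text \<open>Implicit differentiation of a fixed-point equation affine in \<open>\<epsilon>\<close>.
  Subtracting the linear part \<open>d *\<^sub>R h \<epsilon>\<close> leaves the remainder of
  \<open>G\<close> and \<open>\<epsilon>\<close> times the variation of \<open>R\<close>. The a
  priori bound on \<open>h\<close> makes both of order less than \<open>\<epsilon>\<close>.\<close>

lemma fixed_point_derivative:
  fixes G R :: "'a::real_normed_vector \<Rightarrow> 'a"
  assumes \<delta>: "0 < \<delta>" and fp: "\<And>\<epsilon>. \<bar>\<epsilon>\<bar> < \<delta> \<Longrightarrow> h \<epsilon> = G (h \<epsilon>) + \<epsilon> *\<^sub>R R (h \<epsilon>)"
    and bound: "\<And>\<epsilon>. \<bar>\<epsilon>\<bar> < \<delta> \<Longrightarrow> norm (h \<epsilon>) \<le> C * \<bar>\<epsilon>\<bar>"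
    and G: "(G has_derivative (\<lambda>w. d *\<^sub>R w)) (at 0)" "G 0 = 0"
    and R: "isCont R 0" and d: "d < 1"
  shows "(h has_vector_derivative (1 / (1 - d)) *\<^sub>R R 0) (at 0)"
  unfolding has_vector_derivative_def has_derivative_at_alt
proof (intro conjI allI impI)
  fix e :: real assume e: "0 < e"
  define B where "B = \<bar>C\<bar> + 1"
  have B: "0 < B" "C \<le> B" by (auto simp: B_def)
  \<comment> \<open>After division by \<open>1 - d\<close> the error \<open>e\<close> is split
    equally between the nonlinearity of \<open>G\<close> and the variation of
    \<open>R\<close>.\<close>
  define e1 where "e1 = e * (1 - d) / 2"
  have e1: "0 < e1" "0 < e1 / B" using e d B by (auto simp: e1_def)
  obtain \<delta>1 where \<delta>1: "0 < \<delta>1" "\<And>x. norm x < \<delta>1 \<Longrightarrow> norm (G x - d *\<^sub>R x) \<le> e1 / B * norm x"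
    using G e1(2) unfolding has_derivative_at_alt by (metis diff_zero)
  obtain \<delta>2 where \<delta>2: "0 < \<delta>2" "\<And>x. norm x < \<delta>2 \<Longrightarrow> norm (R x - R 0) < e1"
    using R e1(1) unfolding continuous_at dist_norm LIM_eq by (metis diff_zero norm_zero diff_self)
  define \<eta> where "\<eta> = min \<delta> (min \<delta>1 \<delta>2 / B)"
  have "0 < \<eta>" using \<delta> \<delta>1(1) \<delta>2(1) B by (simp add: \<eta>_def)
  moreover have "norm (h \<epsilon> - h 0 - (\<epsilon> - 0) *\<^sub>R ((1 / (1 - d)) *\<^sub>R R 0)) \<le> e * norm (\<epsilon> - 0)"
    if "norm (\<epsilon> - 0) < \<eta>" for \<epsilon>
  proof -
    have \<epsilon>: "\<bar>\<epsilon>\<bar> < \<delta>" "B * \<bar>\<epsilon>\<bar> < \<delta>1" "B * \<bar>\<epsilon>\<bar> < \<delta>2"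
      using that B by (auto simp: \<eta>_def field_simps)
    have h0: "h 0 = 0" using bound[of 0] \<delta> by simp
    have "C * \<bar>\<epsilon>\<bar> \<le> B * \<bar>\<epsilon>\<bar>" using B by (intro mult_right_mono) auto
    with bound[OF \<epsilon>(1)] have hB: "norm (h \<epsilon>) \<le> B * \<bar>\<epsilon>\<bar>" by linarith
    have "(1 - d) *\<^sub>R (h \<epsilon> - \<epsilon> *\<^sub>R ((1 / (1 - d)) *\<^sub>R R 0))
       = h \<epsilon> - d *\<^sub>R h \<epsilon> - \<epsilon> *\<^sub>R R 0"
      using d by (simp add: algebra_simps) (simp flip: scaleR_left_diff_distrib add: field_simps)
    also have "\<dots> = (G (h \<epsilon>) - d *\<^sub>R h \<epsilon>) + \<epsilon> *\<^sub>R (R (h \<epsilon>) - R 0)"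
      by (subst (1) fp[OF \<epsilon>(1)]) (simp add: algebra_simps)
    also have "norm \<dots> \<le> e1 / B * norm (h \<epsilon>) + \<bar>\<epsilon>\<bar> * e1"
    proof (intro norm_triangle_le add_mono)
      show "norm (G (h \<epsilon>) - d *\<^sub>R h \<epsilon>) \<le> e1 / B * norm (h \<epsilon>)"
        using \<delta>1(2) hB \<epsilon> by simp
      show "norm (\<epsilon> *\<^sub>R (R (h \<epsilon>) - R 0)) \<le> \<bar>\<epsilon>\<bar> * e1"
        using \<delta>2(2)[of "h \<epsilon>"] hB \<epsilon> by (simp add: mult_left_mono less_imp_le)
    qed
    also have "\<dots> \<le> e1 / B * (B * \<bar>\<epsilon>\<bar>) + \<bar>\<epsilon>\<bar> * e1"
      using hB e1 by (intro add_right_mono mult_left_mono) auto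
    also have "\<dots> = (1 - d) * (e * \<bar>\<epsilon>\<bar>)" using B by (simp add: e1_def field_simps)
    finally have "(1 - d) * norm (h \<epsilon> - \<epsilon> *\<^sub>R ((1 / (1 - d)) *\<^sub>R R 0)) \<le> (1 - d) * (e * \<bar>\<epsilon>\<bar>)"
      using d by simp
    then show ?thesis using d h0 by simp
  qed
  ultimately show "\<exists>\<eta>>0. \<forall>\<epsilon>. norm (\<epsilon> - 0) < \<eta> \<longrightarrow>
      norm (h \<epsilon> - h 0 - (\<epsilon> - 0) *\<^sub>R ((1 / (1 - d)) *\<^sub>R R 0)) \<le> e * norm (\<epsilon> - 0)"
    by blast
qed (rule bounded_linear_scaleR_left)

text \<open>The difference of the two sides has derivative \<open>y * sin y\<close>. The inequality
  will show that the centroid of an arc is at least as far from the origin as the midpoint of its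
  chord.\<close>

lemma cos_times_le_sin:
  assumes "0 \<le> x" "x \<le> pi"
  shows "x * cos x \<le> sin x"
proof -
  have "(\<lambda>x. sin x - x * cos x) 0 \<le> (\<lambda>x. sin x - x * cos x) x"
  proof (rule DERIV_nonneg_imp_nondecreasing[OF assms(1)])
    fix y assume y: "0 \<le> y" "y \<le> x"
    have "((\<lambda>x. sin x - x * cos x) has_real_derivative y * sin y) (at y)"
      by (auto intro!: derivative_eq_intros)
    moreover have "0 \<le> y * sin y" using y assms by (intro mult_nonneg_nonneg sin_ge_zero) auto
    ultimately show "\<exists>D. ((\<lambda>x. sin x - x * cos x) has_real_derivative D) (at y) \<and> 0 \<le> D" by blast
  qed
  then show ?thesis by simp
qed

context sector_model
begin

section \<open>Arc averages and the response at zero field\<close>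

definition \<theta> where "\<theta> = 2 * pi / real q"
definition mid where "mid k = \<theta> * (real k - 1 / 2)"
text \<open>The distance from the origin of the centroid of an arc of angle \<open>\<theta>\<close>
  under uniform weight.\<close>

definition arc_mean where "arc_mean = sin (\<theta> / 2) / (\<theta> / 2)"
text \<open>The derivative of \<^term>\<open>total_mean (eqdist q)\<close> at \<open>0\<close> is the scalar \<open>response\<close>.\<close>

definition response where "response = \<beta> * (1 - arc_mean\<^sup>2) / 2"

lemma theta: "0 < \<theta>" "\<theta> / 2 = pi / real q" "lo k = mid k - \<theta> / 2" "hi k = mid k + \<theta> / 2"
  using q_pos by (auto simp: \<theta>_def mid_def field_simps)

lemma Z_zero: "Z k 0 = \<theta>"
  using theta(1) unfolding Z_def sector_tilt_def theta(3,4) by (simp add: tilt_zero)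

lemma integral_cos_arc: "integral {m - \<theta> / 2..m + \<theta> / 2} (\<lambda>s. cos (c * s)) = 2 * sin (c * \<theta> / 2) * cos (c * m) / c"
  and integral_sin_arc: "integral {m - \<theta> / 2..m + \<theta> / 2} (\<lambda>s. sin (c * s)) = 2 * sin (c * \<theta> / 2) * sin (c * m) / c"
  if c: "c \<noteq> 0"
proof -
  have e: "c * (m + \<theta> / 2) = c * m + c * \<theta> / 2" "c * (m - \<theta> / 2) = c * m - c * \<theta> / 2"
    by (simp_all add: algebra_simps)
  have "((\<lambda>s. cos (c * s)) has_integral sin (c * (m + \<theta> / 2)) / c - sin (c * (m - \<theta> / 2)) / c) {m - \<theta> / 2..m + \<theta> / 2}"
    by (rule fundamental_theorem_of_calculus)
       (use theta(1) c in \<open>auto intro!: derivative_eq_intros simp flip: has_real_derivative_iff_has_vector_derivative\<close>)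
  from integral_unique[OF this]
  show "integral {m - \<theta> / 2..m + \<theta> / 2} (\<lambda>s. cos (c * s)) = 2 * sin (c * \<theta> / 2) * cos (c * m) / c"
    unfolding e sin_add sin_diff by (simp add: add_divide_distrib diff_divide_distrib)
  have "((\<lambda>s. sin (c * s)) has_integral - cos (c * (m + \<theta> / 2)) / c - - cos (c * (m - \<theta> / 2)) / c) {m - \<theta> / 2..m + \<theta> / 2}"
    by (rule fundamental_theorem_of_calculus)
       (use theta(1) c in \<open>auto intro!: derivative_eq_intros simp flip: has_real_derivative_iff_has_vector_derivative\<close>)
  from integral_unique[OF this]
  show "integral {m - \<theta> / 2..m + \<theta> / 2} (\<lambda>s. sin (c * s)) = 2 * sin (c * \<theta> / 2) * sin (c * m) / c"
    unfolding e cos_add cos_diff by (simp add: add_divide_distrib diff_divide_distrib)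
qed

lemma mean_zero: "mean k 0 = arc_mean *\<^sub>R e_vec (mid k)"
  using Z_zero[of k] integral_cos_arc[of 1 "mid k"] integral_sin_arc[of 1 "mid k"]
  unfolding mean_def tilt_mean_def theta(3,4) Z_def sector_tilt_def
  by (simp add: tilt_zero arc_mean_def e_vec_def)

lemma sum_cis_mid:
  fixes m :: int
  assumes "\<not> int q dvd m"
  shows "(\<Sum>k=1..q. cos (m * mid k)) = 0" "(\<Sum>k=1..q. sin (m * mid k)) = 0"
proof -
  have "cis (m * mid k) = cis (- m * \<theta> / 2) * cis (2 * pi * m * k / q)" for k
    by (simp add: cis_mult mid_def \<theta>_def algebra_simps add_divide_distrib diff_divide_distrib)
  then have "(\<Sum>k=1..q. cis (m * mid k)) = 0"
    using sum_cis_multiples[of q m] q_ge_3 assms by (simp flip: sum_distrib_left)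
  then have "Re (\<Sum>k=1..q. cis (m * mid k)) = 0" "Im (\<Sum>k=1..q. cis (m * mid k)) = 0" by simp_all
  then show "(\<Sum>k=1..q. cos (m * mid k)) = 0" "(\<Sum>k=1..q. sin (m * mid k)) = 0"
    by (simp_all add: Re_sum Im_sum)
qed

lemma not_dvd_small: "\<not> int q dvd 1" "\<not> int q dvd 2"
  using q_ge_3 by (auto dest: zdvd_imp_le)

text \<open>The sector centroids are equally spaced on a circle and cancel. Thus zero is the fixed
  point at the equidistribution, and all later derivatives are taken at zero field.\<close>

lemma total_mean_eqdist_zero: "total_mean (eqdist q) 0 = 0"
proof -
  have "total_mean (eqdist q) 0 = (\<Sum>k=1..q. (arc_mean / real q) *\<^sub>R e_vec (mid k))"
    unfolding total_mean_def by (intro sum.cong) (auto simp: eqdist_def mean_zero)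
  then show ?thesis
    using sum_cis_mid[OF not_dvd_small(1)]
    by (simp add: e_vec_def prod_eq_iff fst_sum snd_sum flip: sum_distrib_left sum_divide_distrib)
qed

text \<open>A product of two linear forms on the circle is half their inner product plus a second
  harmonic. Uniform averaging over an arc only rescales the harmonic. Its coefficients stay
  anonymous because the harmonic cancels when summed over sectors.\<close>

lemma tilt_cov_zero:
  "\<exists>x y. \<forall>k. tilt_cov \<beta> (lo k) (hi k) 0 u w
    = (1 - arc_mean\<^sup>2) / 2 * (u \<bullet> w) + x * cos (2 * mid k) + y * sin (2 * mid k)"
proof -
  define x where "x = (fst u * fst w - snd u * snd w) / 2"
  define y where "y = (fst u * snd w + snd u * fst w) / 2"
  have prod: "(u \<bullet> e_vec s) * (w \<bullet> e_vec s) = (u \<bullet> w) / 2 + (x * cos (2 * s) + y * sin (2 * s))" for s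
  proof -
    have 1: "sin s * sin s = 1 - cos s * cos s"
      using sin_cos_squared_add[of s] by (simp add: power2_eq_square)
    then have 2: "sin s * (sin s * z) = z - cos s * (cos s * z)" for z
      by (simp flip: mult.assoc) (simp add: algebra_simps)
    show ?thesis
      unfolding cos_double sin_double
      by (simp add: 1 2 x_def y_def e_vec_def inner_prod_def power2_eq_square field_simps)
  qed
  \<comment> \<open>The factor of the second harmonic after averaging over an arc, less the share
    taken by the product of the means.\<close>
  define r where "r = sin \<theta> / \<theta> - arc_mean\<^sup>2"
  have "tilt_cov \<beta> (lo k) (hi k) 0 u w
    = (1 - arc_mean\<^sup>2) / 2 * (u \<bullet> w) + (r * x) * cos (2 * mid k) + (r * y) * sin (2 * mid k)" for k
  proof -
    let ?I = "\<lambda>f. integral {mid k - \<theta> / 2..mid k + \<theta> / 2} f"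
    have "?I (\<lambda>s. (u \<bullet> e_vec s) * (w \<bullet> e_vec s)) = ?I (\<lambda>s. (u \<bullet> w) / 2) + ?I (\<lambda>s. x * cos (2 * s) + y * sin (2 * s))"
      unfolding prod by (intro integral_add integrable_continuous_real continuous_intros)
    also have "?I (\<lambda>s. x * cos (2 * s) + y * sin (2 * s)) = ?I (\<lambda>s. x * cos (2 * s)) + ?I (\<lambda>s. y * sin (2 * s))"
      by (intro integral_add integrable_continuous_real continuous_intros)
    also have "?I (\<lambda>s. (u \<bullet> w) / 2) = \<theta> * (u \<bullet> w) / 2" using theta(1) by simp
    finally have "?I (\<lambda>s. (u \<bullet> e_vec s) * (w \<bullet> e_vec s))
        = \<theta> * (u \<bullet> w) / 2 + sin \<theta> * (x * cos (2 * mid k) + y * sin (2 * mid k))"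
      by (simp add: integral_cos_arc integral_sin_arc distrib_left mult.left_commute[of "sin \<theta>"])
    then have "tilt \<beta> (lo k) (hi k) (\<lambda>s. (u \<bullet> e_vec s) * (w \<bullet> e_vec s)) 0 / tilt \<beta> (lo k) (hi k) (\<lambda>s. 1) 0
        = (u \<bullet> w) / 2 + sin \<theta> / \<theta> * (x * cos (2 * mid k) + y * sin (2 * mid k))"
      using Z_zero[of k] theta(1) unfolding Z_def sector_tilt_def theta(3,4)
      by (simp add: tilt_zero add_divide_distrib)
    moreover have "(u \<bullet> mean k 0) * (w \<bullet> mean k 0)
        = arc_mean\<^sup>2 * ((u \<bullet> e_vec (mid k)) * (w \<bullet> e_vec (mid k)))"
      by (simp add: mean_zero power2_eq_square)
    ultimately show ?thesis
      unfolding tilt_cov_def mean_def[symmetric] prod by (simp add: r_def algebra_simps diff_divide_distrib)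
  qed
  then show ?thesis by blast
qed

lemma has_derivative_mean: "(mean k has_derivative
    (\<lambda>w. (\<beta> * tilt_cov \<beta> (lo k) (hi k) h (1, 0) w, \<beta> * tilt_cov \<beta> (lo k) (hi k) h (0, 1) w))) (at h)"
proof -
  have "mean k = (\<lambda>h. ((1, 0) \<bullet> tilt_mean \<beta> (lo k) (hi k) h, (0, 1) \<bullet> tilt_mean \<beta> (lo k) (hi k) h))"
    by (simp add: mean_def fun_eq_iff prod_eq_iff inner_prod_def)
  then show ?thesis
    using has_derivative_Pair[OF has_derivative_inner_tilt_mean[OF lo_less_hi] has_derivative_inner_tilt_mean[OF lo_less_hi]]
    by simp
qed

text \<open>For \<open>q \<ge> 3\<close> the number \<open>q\<close> does not divide
  \<open>2\<close>, so the second harmonics of the sector covariances cancel and an isotropic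
  derivative remains.\<close>

lemma has_derivative_total_mean_eqdist:
  "(total_mean (eqdist q) has_derivative (\<lambda>w. response *\<^sub>R w)) (at 0)"
proof -
  let ?D = "\<lambda>k w. (\<beta> * tilt_cov \<beta> (lo k) (hi k) 0 (1, 0) w, \<beta> * tilt_cov \<beta> (lo k) (hi k) 0 (0, 1) w)"
  have "(total_mean (eqdist q) has_derivative (\<lambda>w. \<Sum>k=1..q. eqdist q k *\<^sub>R ?D k w)) (at 0)"
    unfolding total_mean_def[abs_def]
    by (intro has_derivative_sum has_derivative_scaleR_right has_derivative_mean)
  moreover have cov: "(\<Sum>k=1..q. eqdist q k * (\<beta> * tilt_cov \<beta> (lo k) (hi k) 0 u w)) = response * (u \<bullet> w)" for u w
  proof -
    obtain x y where C: "\<And>k. tilt_cov \<beta> (lo k) (hi k) 0 u w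
      = (1 - arc_mean\<^sup>2) / 2 * (u \<bullet> w) + x * cos (2 * mid k) + y * sin (2 * mid k)"
      using tilt_cov_zero by blast
    have "(\<Sum>k=1..q. eqdist q k * (\<beta> * tilt_cov \<beta> (lo k) (hi k) 0 u w))
        = (\<Sum>k=1..q. \<beta> / real q * ((1 - arc_mean\<^sup>2) / 2 * (u \<bullet> w) + x * cos (2 * mid k) + y * sin (2 * mid k)))"
      unfolding C by (intro sum.cong) (auto simp: eqdist_def)
    also have "\<dots> = response * (u \<bullet> w)"
      unfolding sum_distrib_left[symmetric] sum.distrib
      using sum_cis_mid[OF not_dvd_small(2)] q_pos by (simp add: response_def)
    finally show ?thesis .
  qed
  have "(\<Sum>k=1..q. eqdist q k *\<^sub>R ?D k w) = response *\<^sub>R w" for w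
    using cov[of "(1, 0)" w] cov[of "(0, 1)" w]
    by (simp add: prod_eq_iff fst_sum snd_sum inner_prod_def)
  ultimately show ?thesis by simp
qed

text \<open>Comparing the arc centroid with the chord midpoint bounds
  \<open>1 - arc_mean\<^sup>2\<close> by \<open>(sin (pi / real q))\<^sup>2\<close>, so
  \<open>response\<close> is at most half of \<open>\<kappa>\<close>.\<close>

lemma response_less_1: "response < 1"
proof -
  have "cos (pi / real q) \<le> arc_mean"
    using cos_times_le_sin[of "pi / real q"] q_ge_3 unfolding arc_mean_def theta(2)
    by (simp add: field_simps)
  moreover have "0 \<le> pi / real q" "pi / real q \<le> pi / 2"
    using q_ge_3 by (auto simp: field_simps)
  then have "0 \<le> cos (pi / real q)"
    using pi_ge_zero by (intro cos_ge_zero) linarith+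
  ultimately have "(cos (pi / real q))\<^sup>2 \<le> arc_mean\<^sup>2" by (intro power_mono)
  then have "1 - arc_mean\<^sup>2 \<le> (sin (pi / real q))\<^sup>2" by (simp add: sin_squared_eq)
  then have "\<beta> * (1 - arc_mean\<^sup>2) \<le> \<kappa>" unfolding \<kappa>_def using beta_pos by (intro mult_left_mono) auto
  then show ?thesis using kappa by (simp add: response_def)
qed

section \<open>Differentiating the magnetisation along a perturbation of the weights\<close>

definition perturbed where "perturbed \<rho> \<epsilon> j = eqdist q j + \<epsilon> * \<rho> j"

text \<open>\<open>M_beta_eq\<close> needs strictly positive weights, and a derivative at zero needs
  them for a whole interval of \<open>\<epsilon>\<close>.\<close>

lemma perturbed_prob:
  assumes "\<rho> \<in> Vspace q"
  obtains \<delta> where "0 < \<delta>"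
    and "\<And>\<epsilon>. \<bar>\<epsilon>\<bar> < \<delta> \<Longrightarrow> \<forall>k\<in>{1..q}. 0 < perturbed \<rho> \<epsilon> k"
    and "\<And>\<epsilon>. (\<Sum>k=1..q. perturbed \<rho> \<epsilon> k) = 1"
proof -
  \<comment> \<open>Larger than every \<open>\<bar>\<rho> k\<bar>\<close>, and positive even for
    \<open>\<rho> = 0\<close>.\<close>
  define b where "b = (\<Sum>k=1..q. \<bar>\<rho> k\<bar>) + 1"
  have b: "0 < b" unfolding b_def by (smt (verit) sum_nonneg abs_ge_zero)
  show thesis
  proof (rule that[of "1 / (real q * b)"])
    show "0 < 1 / (real q * b)" using b q_pos by simp
    show "(\<Sum>k=1..q. perturbed \<rho> \<epsilon> k) = 1" for \<epsilon>
      using assms q_pos by (simp add: perturbed_def sum.distrib eqdist_def Vspace_def flip: sum_distrib_left)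
    show "\<forall>k\<in>{1..q}. 0 < perturbed \<rho> \<epsilon> k" if \<epsilon>: "\<bar>\<epsilon>\<bar> < 1 / (real q * b)" for \<epsilon>
    proof
      fix k assume k: "k \<in> {1..q}"
      have "\<bar>\<rho> k\<bar> \<le> (\<Sum>k=1..q. \<bar>\<rho> k\<bar>)"
        using k by (intro member_le_sum) auto
      then have "\<bar>\<epsilon> * \<rho> k\<bar> \<le> \<bar>\<epsilon>\<bar> * b" by (simp add: abs_mult b_def mult_left_mono)
      also have "\<dots> < 1 / (real q * b) * b" using \<epsilon> b by (intro mult_strict_right_mono)
      also have "\<dots> = 1 / real q" using b by simp
      finally show "0 < perturbed \<rho> \<epsilon> k" using k by (simp add: perturbed_def eqdist_def)
    qed
  qed
qed

definition M_deriv where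
  "M_deriv \<rho> = (arc_mean / (1 - response)) *\<^sub>R (\<Sum>k=1..q. \<rho> k *\<^sub>R e_vec (mid k))"

lemma M_beta_has_derivative:
  assumes \<rho>: "\<rho> \<in> Vspace q"
  shows "((\<lambda>\<epsilon>. M_beta \<beta> q (perturbed \<rho> \<epsilon>)) has_vector_derivative M_deriv \<rho>) (at 0)"
    and "M_beta \<beta> q (perturbed \<rho> 0) = 0"
proof -
  define h where "h \<epsilon> = M_beta \<beta> q (perturbed \<rho> \<epsilon>)" for \<epsilon>
  define R where "R = total_mean \<rho>"
  obtain \<delta> where \<delta>: "0 < \<delta>"
    "\<And>\<epsilon>. \<bar>\<epsilon>\<bar> < \<delta> \<Longrightarrow> \<forall>k\<in>{1..q}. 0 < perturbed \<rho> \<epsilon> k"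
    "\<And>\<epsilon>. (\<Sum>k=1..q. perturbed \<rho> \<epsilon> k) = 1"
    using perturbed_prob[OF \<rho>] by blast
  have nonneg: "\<forall>k\<in>{1..q}. 0 \<le> perturbed \<rho> \<epsilon> k" if "\<bar>\<epsilon>\<bar> < \<delta>" for \<epsilon>
    using \<delta>(2)[OF that] by (auto intro: less_imp_le)
  \<comment> \<open>\<open>total_mean\<close> is linear in the weights, so the fixed-point equation
    is affine in \<open>\<epsilon>\<close>.\<close>
  have split: "total_mean (perturbed \<rho> \<epsilon>) x = total_mean (eqdist q) x + \<epsilon> *\<^sub>R R x" for \<epsilon> x
    by (simp add: total_mean_def perturbed_def R_def scaleR_left_distrib sum.distrib scaleR_sum_right)
  have fp: "total_mean (perturbed \<rho> \<epsilon>) (h \<epsilon>) = h \<epsilon>" if small: "\<bar>\<epsilon>\<bar> < \<delta>" for \<epsilon>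
  proof -
    obtain x where x: "total_mean (perturbed \<rho> \<epsilon>) x = x"
      using ex1_fixed_point[OF nonneg[OF small] \<delta>(3)] by blast
    then show ?thesis using M_beta_eq[OF \<delta>(2)[OF small] \<delta>(3) x] by (simp add: h_def)
  qed
  \<comment> \<open>Comparison with field zero, where the value is
    \<open>\<epsilon> *\<^sub>R R 0\<close>: the contraction absorbs the rest.\<close>
  have bound: "norm (h \<epsilon>) \<le> norm (R 0) / (1 - \<kappa>) * \<bar>\<epsilon>\<bar>" if "\<bar>\<epsilon>\<bar> < \<delta>" for \<epsilon>
  proof -
    have "norm (h \<epsilon> - \<epsilon> *\<^sub>R R 0) \<le> \<kappa> * norm (h \<epsilon> - 0)"
      using total_mean_lipschitz[OF nonneg[OF that] \<delta>(3), of "h \<epsilon>" 0] fp[OF that]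
      by (simp add: split total_mean_eqdist_zero)
    then have "norm (h \<epsilon>) - \<bar>\<epsilon>\<bar> * norm (R 0) \<le> \<kappa> * norm (h \<epsilon>)"
      using norm_triangle_ineq2[of "h \<epsilon>" "\<epsilon> *\<^sub>R R 0"] by simp
    then show ?thesis using kappa by (simp add: field_simps)
  qed
  have "isCont R 0"
    unfolding R_def total_mean_def[abs_def]
    by (intro continuous_intros has_derivative_continuous[OF has_derivative_mean])
  then have "(h has_vector_derivative (1 / (1 - response)) *\<^sub>R R 0) (at 0)"
    using fp bound \<delta>(1) total_mean_eqdist_zero response_less_1 has_derivative_total_mean_eqdist
    by (intro fixed_point_derivative[of \<delta> h "total_mean (eqdist q)" R "norm (R 0) / (1 - \<kappa>)"]) (simp_all add: split)
  moreover have "(1 / (1 - response)) *\<^sub>R R 0 = M_deriv \<rho>"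
    by (simp add: R_def total_mean_def mean_zero M_deriv_def scaleR_sum_right mult.commute)
  ultimately show "((\<lambda>\<epsilon>. M_beta \<beta> q (perturbed \<rho> \<epsilon>)) has_vector_derivative M_deriv \<rho>) (at 0)"
    by (simp add: h_def[abs_def])
  show "M_beta \<beta> q (perturbed \<rho> 0) = 0"
    using bound[of 0] \<delta>(1) by (simp add: h_def)
qed

section \<open>Jump rates and the linearised vector field\<close>

lemma c_rate_eq: "c_rate \<beta> q k p
    = exp (\<beta> * (e_vec (\<theta> * real k) \<bullet> M_beta \<beta> q p)) / Z k (M_beta \<beta> q p)"
proof -
  have "(LINT \<omega>:sector q k|lborel. exp (\<beta> * inner2 (e_vec \<omega>) (M_beta \<beta> q p))) = Z k (M_beta \<beta> q p)"
    using sector_integral[of "\<lambda>s. 1" k "M_beta \<beta> q p"]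
    by (simp add: inner2_eq_inner inner_commute Z_def)
  then show ?thesis by (simp add: c_rate_def inner2_eq_inner \<theta>_def mult.commute)
qed

text \<open>At zero field the logarithmic derivative of the rate is \<open>\<beta>\<close> times the
  difference between the upper endpoint of the sector, from the numerator, and its centroid, from
  the normaliser.\<close>

lemma c_rate_has_derivative:
  assumes \<rho>: "\<rho> \<in> Vspace q"
  shows "((\<lambda>\<epsilon>. c_rate \<beta> q k (perturbed \<rho> \<epsilon>)) has_real_derivative
      \<beta> / \<theta> * ((e_vec (\<theta> * real k) - arc_mean *\<^sub>R e_vec (mid k)) \<bullet> M_deriv \<rho>)) (at 0)"
    and "c_rate \<beta> q k (perturbed \<rho> 0) = 1 / \<theta>"
proof -
  define h where "h \<epsilon> = M_beta \<beta> q (perturbed \<rho> \<epsilon>)" for \<epsilon>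
  have h0: "h 0 = 0" using M_beta_has_derivative(2)[OF \<rho>] by (simp add: h_def)
  have hd: "(h has_derivative (\<lambda>x. x *\<^sub>R M_deriv \<rho>)) (at 0)"
    using M_beta_has_derivative(1)[OF \<rho>] by (simp add: h_def[abs_def] has_vector_derivative_def)
  have Zd: "(Z k has_derivative (\<lambda>w. \<beta> * (w \<bullet> mean k 0) * \<theta>)) (at 0)"
    using has_derivative_tilt[of "lo k" "hi k" "\<lambda>s. 1" \<beta> 0 UNIV] Z_pos[of k 0] Z_zero[of k]
    by (simp add: Z_def[abs_def] sector_tilt_def mean_def inner_tilt_mean)
  have "((\<lambda>x. exp (\<beta> * (e_vec (\<theta> * real k) \<bullet> x)) / Z k x) has_derivative
     (\<lambda>w. \<beta> / \<theta> * ((e_vec (\<theta> * real k) - arc_mean *\<^sub>R e_vec (mid k)) \<bullet> w))) (at (h 0))"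
    unfolding h0
    by (rule derivative_eq_intros Zd refl)+
      (use theta(1) in \<open>auto simp: Z_zero mean_zero inner_diff_left inner_diff_right inner_commute field_simps fun_eq_iff\<close>)
  from has_derivative_compose[OF hd this]
  show "((\<lambda>\<epsilon>. c_rate \<beta> q k (perturbed \<rho> \<epsilon>)) has_real_derivative
      \<beta> / \<theta> * ((e_vec (\<theta> * real k) - arc_mean *\<^sub>R e_vec (mid k)) \<bullet> M_deriv \<rho>)) (at 0)"
    unfolding c_rate_eq h_def[symmetric]
    by (rule has_derivative_imp_has_field_derivative) simp
  show "c_rate \<beta> q k (perturbed \<rho> 0) = 1 / \<theta>"
    unfolding c_rate_eq h_def[symmetric] h0 by (simp add: Z_zero)
qed

text \<open>The product of \<open>\<beta> / \<theta>\<close> from the rate,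
  \<open>arc_mean / (1 - response)\<close> from \<open>M_deriv\<close> and the weight
  \<open>1 / real q\<close>, with \<open>real q * \<theta> = 2 * pi\<close>.\<close>

definition coupling where "coupling = \<beta> * arc_mean / (2 * pi * (1 - response))"

text \<open>The linearised current leaving sector \<open>k\<close>. The shift \<open>1 / 2\<close>
  in the first cosine arises because the rate is evaluated at the sector end, half a sector beyond
  its midpoint.\<close>

definition flux :: "(nat \<Rightarrow> real) \<Rightarrow> nat \<Rightarrow> real" where
  "flux \<rho> k = \<rho> k / \<theta> + coupling * (\<Sum>j=1..q. \<rho> j *
     (cos (\<theta> * (real k - real j + 1 / 2)) - arc_mean * cos (\<theta> * (real k - real j))))"

lemma prev_idx_in: "k \<in> {1..q} \<Longrightarrow> prev_idx q k \<in> {1..q}"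
  by (auto simp: prev_idx_def)

lemma flux_has_derivative:
  assumes \<rho>: "\<rho> \<in> Vspace q" and k: "k \<in> {1..q}"
  shows "((\<lambda>\<epsilon>. c_rate \<beta> q k (perturbed \<rho> \<epsilon>) * perturbed \<rho> \<epsilon> k) has_real_derivative flux \<rho> k) (at 0)"
proof -
  let ?v = "e_vec (\<theta> * real k) - arc_mean *\<^sub>R e_vec (mid k)"
  have "?v \<bullet> M_deriv \<rho> = arc_mean / (1 - response) * (\<Sum>j=1..q. \<rho> j *
     (cos (\<theta> * (real k - real j + 1 / 2)) - arc_mean * cos (\<theta> * (real k - real j))))"
  proof -
    have "?v \<bullet> e_vec (mid j) = cos (\<theta> * (real k - real j + 1 / 2)) - arc_mean * cos (\<theta> * (real k - real j))" for j
    proof -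
      have "\<theta> * real k - mid j = \<theta> * (real k - real j + 1 / 2)" "mid k - mid j = \<theta> * (real k - real j)"
        by (simp_all add: mid_def algebra_simps)
      then show ?thesis by (simp add: inner_diff_left inner_e_vec_e_vec)
    qed
    then show ?thesis by (simp add: M_deriv_def inner_sum_right)
  qed
  moreover have "((\<lambda>\<epsilon>. perturbed \<rho> \<epsilon> k) has_real_derivative \<rho> k) (at 0)"
    unfolding perturbed_def by (auto intro!: derivative_eq_intros)
  note DERIV_mult[OF c_rate_has_derivative(1)[OF \<rho>, of k] this]
  moreover have "perturbed \<rho> 0 k = 1 / real q" using k by (simp add: perturbed_def eqdist_def)
  moreover have "1 / (real q * \<theta>) = 1 / (2 * pi)" using q_pos by (simp add: \<theta>_def)
  ultimately show ?thesis
    unfolding flux_def coupling_def c_rate_has_derivative(2)[OF \<rho>]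
    by (auto elim!: DERIV_cong simp: field_simps)
qed

lemma F_field_has_derivative:
  assumes \<rho>: "\<rho> \<in> Vspace q"
  shows "((\<lambda>\<epsilon>. F_field \<beta> q (\<lambda>j. eqdist q j + \<epsilon> * \<rho> j) k) has_real_derivative
     (if k \<in> {1..q} then flux \<rho> (prev_idx q k) - flux \<rho> k else 0)) (at 0)"
proof (cases "k \<in> {1..q}")
  case True
  then show ?thesis
    using DERIV_diff[OF flux_has_derivative[OF \<rho> prev_idx_in[OF True]] flux_has_derivative[OF \<rho> True]]
    by (simp add: F_field_def perturbed_def[abs_def])
next
  case False
  then have "(\<lambda>\<epsilon>. F_field \<beta> q (\<lambda>j. eqdist q j + \<epsilon> * \<rho> j) k) = (\<lambda>\<epsilon>. 0)"
    by (auto simp: F_field_def)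
  with False show ?thesis by auto
qed

lemma Lin_eq:
  assumes "\<rho> \<in> Vspace q"
  shows "Lin \<beta> q \<rho> k = (if k \<in> {1..q} then flux \<rho> (prev_idx q k) - flux \<rho> k else 0)"
  unfolding Lin_def by (rule DERIV_imp_deriv[OF F_field_has_derivative[OF assms]])

lemma sum_prev_idx: "(\<Sum>k=1..q. f (prev_idx q k)) = (\<Sum>k=1..q. f k)"
proof (rule sum.reindex_bij_witness[of _ "\<lambda>k. if k = q then 1 else k + 1" "prev_idx q"])
qed (use q_ge_3 in \<open>auto simp: prev_idx_def split: if_splits\<close>)

lemma Lin_in_Vspace:
  assumes "\<rho> \<in> Vspace q"
  shows "Lin \<beta> q \<rho> \<in> Vspace q"
proof -
  have "(\<Sum>k=1..q. Lin \<beta> q \<rho> k) = (\<Sum>k=1..q. flux \<rho> (prev_idx q k) - flux \<rho> k)"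
    by (intro sum.cong) (auto simp: Lin_eq[OF assms])
  also have "\<dots> = 0" by (simp only: sum_subtractf sum_prev_idx diff_self)
  finally show ?thesis by (simp add: Vspace_def Lin_eq[OF assms])
qed

lemma Vspace_lincomb:
  assumes "\<rho> \<in> Vspace q" "\<sigma> \<in> Vspace q"
  shows "(\<lambda>k. a * \<rho> k + b * \<sigma> k) \<in> Vspace q"
  using assms by (simp add: Vspace_def sum.distrib flip: sum_distrib_left)

lemma Lin_linear:
  assumes "\<rho> \<in> Vspace q" "\<sigma> \<in> Vspace q"
  shows "Lin \<beta> q (\<lambda>k. a * \<rho> k + b * \<sigma> k) = (\<lambda>k. a * Lin \<beta> q \<rho> k + b * Lin \<beta> q \<sigma> k)"
proof -
  have "flux (\<lambda>k. a * \<rho> k + b * \<sigma> k) k = a * flux \<rho> k + b * flux \<sigma> k" for k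
    unfolding flux_def distrib_right sum.distrib
    by (simp add: distrib_left add_divide_distrib mult.assoc mult.left_commute[of coupling] flip: sum_distrib_left)
  then show ?thesis
    by (simp add: fun_eq_iff Lin_eq assms Vspace_lincomb algebra_simps)
qed

end

section \<open>Diagonalisable complex matrices\<close>

lemma order_linear_factor: "order \<mu> [:- a, 1:] = (if \<mu> = a then 1 else 0)" for \<mu> :: "'a::idom"
  using order_power_n_n[of a 1] by (auto intro: order_0I)

text \<open>Reads algebraic multiplicities off a factored characteristic polynomial by counting
  indices, so repeated roots need no separate treatment.\<close>

lemma order_prod_linear_factors:
  fixes \<mu> :: "'a::idom"
  assumes "finite I"
  shows "order \<mu> (\<Prod>i\<in>I. [:- f i, 1:]) = card {i\<in>I. f i = \<mu>}"
  using assms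
proof (induction I)
  case (insert i I)
  have "(\<Prod>i\<in>insert i I. [:- f i, 1:]) \<noteq> 0"
    unfolding prod_zero_iff[OF finite.insertI[OF insert.hyps(1)]] by simp
  then have "order \<mu> (\<Prod>i\<in>insert i I. [:- f i, 1:]) = order \<mu> [:- f i, 1:] + order \<mu> (\<Prod>i\<in>I. [:- f i, 1:])"
    unfolding prod.insert[OF insert.hyps] by (rule order_mult)
  moreover have "{j \<in> insert i I. f j = \<mu>} = (if f i = \<mu> then insert i {j\<in>I. f j = \<mu>} else {j\<in>I. f j = \<mu>})"
    by auto
  ultimately show ?case
    using insert by (simp only: order_linear_factor) (simp split: if_splits)
qed simp

lemma char_poly_mat_diag: "char_poly (mat_diag n f) = (\<Prod>i<n. [:- f i, 1:])"
proof -
  have "char_poly (mat_diag n f) = (\<Prod>a\<leftarrow>diag_mat (mat_diag n f). [:- a, 1:])"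
    by (rule char_poly_upper_triangular[of _ n]) (auto simp: mat_diag_def)
  also have "diag_mat (mat_diag n f) = map f [0..<n]"
    by (simp add: diag_mat_def mat_diag_def)
  also have "(\<Prod>a\<leftarrow>map f [0..<n]. [:- a, 1:]) = (\<Prod>i<n. [:- f i, 1:])"
    by (simp add: o_def prod.distinct_set_conv_list[of "[0..<n]", simplified, symmetric] lessThan_atLeast0)
  finally show ?thesis .
qed

lemma mult_mat_diag_vec:
  fixes y :: "'a::semiring_1 vec"
  assumes "y \<in> carrier_vec n"
  shows "mat_diag n f *\<^sub>v y = Matrix.vec n (\<lambda>i. f i * y $ i)"
proof (rule eq_vecI)
  fix i assume "i < dim_vec (Matrix.vec n (\<lambda>i. f i * y $ i))"
  then have i: "i < n" by simp
  have "(mat_diag n f *\<^sub>v y) $ i = (\<Sum>j = 0..<n. (if i = j then f j else 0) * y $ j)"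
    using i assms by (simp add: mat_diag_def scalar_prod_def)
  also have "\<dots> = (\<Sum>j = 0..<n. if i = j then f j * y $ j else 0)"
    by (intro sum.cong) auto
  finally show "(mat_diag n f *\<^sub>v y) $ i = Matrix.vec n (\<lambda>i. f i * y $ i) $ i"
    using i by simp
qed (simp add: mat_diag_def)

lemma mult_mat_vec_sum:
  fixes B :: "'a::comm_semiring_1 mat"
  assumes "B \<in> carrier_mat n n" "\<And>z. z \<in> S \<Longrightarrow> v z \<in> carrier_vec n" "i < n"
  shows "(B *\<^sub>v Matrix.vec n (\<lambda>i. \<Sum>z\<in>S. v z $ i)) $ i = (\<Sum>z\<in>S. (B *\<^sub>v v z) $ i)"
proof -
  have "(B *\<^sub>v Matrix.vec n (\<lambda>i. \<Sum>z\<in>S. v z $ i)) $ i = (\<Sum>j=0..<n. \<Sum>z\<in>S. B $$ (i, j) * v z $ j)"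
    using assms by (simp add: scalar_prod_def sum_distrib_left)
  also have "\<dots> = (\<Sum>z\<in>S. \<Sum>j=0..<n. B $$ (i, j) * v z $ j)" by (rule sum.swap)
  also have "\<dots> = (\<Sum>z\<in>S. (B *\<^sub>v v z) $ i)"
  proof (rule sum.cong)
    fix z assume "z \<in> S"
    then have "v z \<in> carrier_vec n" by (rule assms(2))
    then show "(\<Sum>j=0..<n. B $$ (i, j) * v z $ j) = (B *\<^sub>v v z) $ i"
      using assms(1,3) by (simp add: scalar_prod_def)
  qed simp
  finally show ?thesis .
qed

text \<open>The columns of \<open>P\<close> are eigenvectors and \<open>Q\<close> reads off
  coordinates. Orthogonality of the modes will supply \<open>Q * P\<close>; for square matrices the
  other product follows.\<close>

locale diagonalized =
  fixes n :: nat and A P Q :: "complex mat" and d :: "nat \<Rightarrow> complex"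
  assumes carrier: "A \<in> carrier_mat n n" "P \<in> carrier_mat n n" "Q \<in> carrier_mat n n"
    and QP: "Q * P = 1\<^sub>m n" and AP: "A * P = P * mat_diag n d"
begin

lemma PQ: "P * Q = 1\<^sub>m n"
  by (rule mat_mult_left_right_inverse[OF carrier(3,2) QP])

lemma A_eq: "A = P * mat_diag n d * Q"
proof -
  have "P * mat_diag n d * Q = A * P * Q" using AP by simp
  also have "\<dots> = A" using carrier PQ by (simp add: assoc_mult_mat[of A n n P n Q n])
  finally show ?thesis by simp
qed

lemma char_poly_eq: "char_poly A = (\<Prod>i<n. [:- d i, 1:])"
proof -
  have "similar_mat A (mat_diag n d)"
    using carrier QP PQ A_eq by (intro similar_matI[of _ _ P Q n]) auto
  then show ?thesis by (simp add: char_poly_similar char_poly_mat_diag)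
qed

lemma shifted_power_P:
  "(A - z \<cdot>\<^sub>m 1\<^sub>m n) ^\<^sub>m k * P = P * mat_diag n (\<lambda>i. (d i - z) ^ k)"
proof (induction k)
  case 0 show ?case using carrier by simp
next
  case (Suc k)
  let ?B = "A - z \<cdot>\<^sub>m 1\<^sub>m n"
  have B: "?B \<in> carrier_mat n n" by (intro minus_carrier_mat smult_carrier_mat one_carrier_mat)
  have "?B * P = A * P - z \<cdot>\<^sub>m 1\<^sub>m n * P"
    using carrier by (intro minus_mult_distrib_mat) auto
  also have "\<dots> = P * mat_diag n d - z \<cdot>\<^sub>m P"
    using carrier AP by (simp add: mult_smult_assoc_mat[of "1\<^sub>m n" n n P n])
  also have "\<dots> = P * mat_diag n (\<lambda>i. d i - z)"
    using carrier unfolding mat_diag_mult_right[OF carrier(2)]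
    by (intro eq_matI) (auto simp: algebra_simps)
  finally have BP: "?B * P = P * mat_diag n (\<lambda>i. d i - z)" .
  have "?B ^\<^sub>m Suc k * P = ?B ^\<^sub>m k * (?B * P)"
    using B carrier by (simp add: assoc_mult_mat[of _ n n ?B n P n])
  also have "\<dots> = ?B ^\<^sub>m k * P * mat_diag n (\<lambda>i. d i - z)"
    unfolding BP using B carrier by (simp add: assoc_mult_mat[of "?B ^\<^sub>m k" n n P n _ n] pow_carrier_mat)
  also have "\<dots> = P * (mat_diag n (\<lambda>i. (d i - z) ^ k) * mat_diag n (\<lambda>i. d i - z))"
    unfolding Suc using carrier by (simp add: assoc_mult_mat[of P n n _ n _ n])
  finally show ?case by (simp add: mult.commute)
qed

lemma shifted_power_apply:
  assumes y: "y \<in> carrier_vec n"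
  shows "(A - z \<cdot>\<^sub>m 1\<^sub>m n) ^\<^sub>m k *\<^sub>v (P *\<^sub>v y) = P *\<^sub>v Matrix.vec n (\<lambda>i. (d i - z) ^ k * y $ i)"
proof -
  have "A - z \<cdot>\<^sub>m 1\<^sub>m n \<in> carrier_mat n n"
    by (intro minus_carrier_mat smult_carrier_mat one_carrier_mat)
  then have "(A - z \<cdot>\<^sub>m 1\<^sub>m n) ^\<^sub>m k \<in> carrier_mat n n" by (rule pow_carrier_mat)
  then show ?thesis
    using carrier y
    by (simp add: shifted_power_P mult_mat_diag_vec assoc_mult_mat_vec[of _ n n P n, symmetric]
        assoc_mult_mat_vec[of P n n _ n])
qed

lemma QP_vec: "y \<in> carrier_vec n \<Longrightarrow> Q *\<^sub>v (P *\<^sub>v y) = y"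
  and PQ_vec: "y \<in> carrier_vec n \<Longrightarrow> P *\<^sub>v (Q *\<^sub>v y) = y"
  using carrier QP PQ
  by (simp_all add: assoc_mult_mat_vec[of Q n n P n, symmetric] assoc_mult_mat_vec[of P n n Q n, symmetric])

text \<open>In the eigenbasis the power multiplies coordinate \<open>i\<close> by
  \<open>(d i - z) ^ k\<close>, which is nonzero when \<open>d i \<noteq> z\<close>.\<close>

lemma generalized_eigenvector_coordinate:
  assumes v: "v \<in> carrier_vec n" "(A - z \<cdot>\<^sub>m 1\<^sub>m n) ^\<^sub>m k *\<^sub>v v = 0\<^sub>v n"
    and i: "i < n" "d i \<noteq> z"
  shows "(Q *\<^sub>v v) $ i = 0"
proof -
  define y where "y = Q *\<^sub>v v"
  have y: "y \<in> carrier_vec n" "P *\<^sub>v y = v" using v carrier by (simp_all add: y_def PQ_vec)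
  have "P *\<^sub>v Matrix.vec n (\<lambda>i. (d i - z) ^ k * y $ i) = 0\<^sub>v n"
    using shifted_power_apply[OF y(1), of z k] v(2) y(2) by simp
  then have "Matrix.vec n (\<lambda>i. (d i - z) ^ k * y $ i) = Q *\<^sub>v 0\<^sub>v n"
    using QP_vec[of "Matrix.vec n (\<lambda>i. (d i - z) ^ k * y $ i)"] by simp
  also have "\<dots> = 0\<^sub>v n" using carrier by (intro eq_vecI) (auto simp: scalar_prod_def)
  finally have "Matrix.vec n (\<lambda>i. (d i - z) ^ k * y $ i) $ i = 0\<^sub>v n $ i" by simp
  then show ?thesis using i by (simp add: y_def)
qed

text \<open>Generalised eigenvectors for \<open>z\<close> have coordinates only where
  \<open>d i = z\<close>. Conversely, a vector without coordinates of nonpositive real part splits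
  along its eigenvalues.\<close>

lemma sum_of_unstable_iff:
  assumes x: "x \<in> carrier_vec n" and n: "0 < n"
  shows "(\<exists>S v. finite S \<and>
        (\<forall>z\<in>S. 0 < Re z \<and> v z \<in> carrier_vec n \<and> (A - z \<cdot>\<^sub>m 1\<^sub>m n) ^\<^sub>m n *\<^sub>v v z = 0\<^sub>v n) \<and>
        x = Matrix.vec n (\<lambda>i. \<Sum>z\<in>S. v z $ i))
     \<longleftrightarrow> (\<forall>i<n. Re (d i) \<le> 0 \<longrightarrow> (Q *\<^sub>v x) $ i = 0)" (is "?L \<longleftrightarrow> ?R")
proof
  assume ?L
  then obtain S v where S: "finite S"
      "\<And>z. z \<in> S \<Longrightarrow> 0 < Re z \<and> v z \<in> carrier_vec n \<and> (A - z \<cdot>\<^sub>m 1\<^sub>m n) ^\<^sub>m n *\<^sub>v v z = 0\<^sub>v n"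
      "x = Matrix.vec n (\<lambda>i. \<Sum>z\<in>S. v z $ i)"
    by blast
  show ?R
  proof (intro allI impI)
    fix i assume i: "i < n" "Re (d i) \<le> 0"
    have "(Q *\<^sub>v x) $ i = (\<Sum>z\<in>S. (Q *\<^sub>v v z) $ i)"
      unfolding S(3) using S(2) i carrier by (intro mult_mat_vec_sum) auto
    also have "\<dots> = 0"
    proof (rule sum.neutral, rule ballI)
      fix z assume z: "z \<in> S"
      have "d i \<noteq> z" using S(2)[OF z] i by auto
      then show "(Q *\<^sub>v v z) $ i = 0"
        using generalized_eigenvector_coordinate[of "v z" z n i] S(2)[OF z] i by blast
    qed
    finally show "(Q *\<^sub>v x) $ i = 0" .
  qed
next
  assume R: ?R
  define y where "y = Q *\<^sub>v x"
  define S where "S = d ` {i. i < n \<and> 0 < Re (d i)}"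
  \<comment> \<open>Coordinates are grouped by eigenvalue, so that indices with equal
    \<open>d i\<close> share one summand.\<close>
  define u where "u z = Matrix.vec n (\<lambda>i. if d i = z then y $ i else 0)" for z
  define v where "v z = P *\<^sub>v u z" for z
  have S: "finite S" by (simp add: S_def)
  have "y = Matrix.vec n (\<lambda>i. \<Sum>z\<in>S. u z $ i)"
  proof (rule eq_vecI)
    fix i assume "i < dim_vec (Matrix.vec n (\<lambda>i. \<Sum>z\<in>S. u z $ i))"
    then have i: "i < n" by simp
    then have "(\<Sum>z\<in>S. u z $ i) = (\<Sum>z\<in>S. if d i = z then y $ i else 0)"
      by (intro sum.cong) (auto simp: u_def)
    also have "\<dots> = (if d i \<in> S then y $ i else 0)" using S by simp
    also have "\<dots> = y $ i" using R i by (auto simp: S_def y_def)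
    finally show "y $ i = Matrix.vec n (\<lambda>i. \<Sum>z\<in>S. u z $ i) $ i" using i by simp
  qed (use carrier in \<open>simp add: y_def\<close>)
  then have "x = P *\<^sub>v Matrix.vec n (\<lambda>i. \<Sum>z\<in>S. u z $ i)"
    using PQ_vec[OF x] by (simp add: y_def)
  also have "\<dots> = Matrix.vec n (\<lambda>i. \<Sum>z\<in>S. v z $ i)"
    using carrier mult_mat_vec_sum[OF carrier(2), of S u]
    by (intro eq_vecI) (auto simp: v_def u_def)
  finally have "x = Matrix.vec n (\<lambda>i. \<Sum>z\<in>S. v z $ i)" .
  moreover have "(A - z \<cdot>\<^sub>m 1\<^sub>m n) ^\<^sub>m n *\<^sub>v v z = 0\<^sub>v n" for z
  proof -
    \<comment> \<open>Where \<open>u z\<close> is nonzero the base \<open>d i - z\<close> is zero,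
      and \<open>0 < n\<close> makes its power vanish.\<close>
    have "Matrix.vec n (\<lambda>i. (d i - z) ^ n * u z $ i) = 0\<^sub>v n"
      using n by (intro eq_vecI) (auto simp: u_def)
    then show ?thesis
      unfolding v_def using shifted_power_apply[of "u z" z n] carrier
      by (simp add: u_def[of z]) (auto intro!: eq_vecI simp: scalar_prod_def)
  qed
  moreover have "v z \<in> carrier_vec n" for z using carrier by (simp add: v_def u_def)
  ultimately show ?L using S by (intro exI[of _ S] exI[of _ v]) (auto simp: S_def)
qed

end

section \<open>Fourier modes\<close>

context sector_model
begin

definition flux_kernel :: "nat \<Rightarrow> nat \<Rightarrow> real" where
  "flux_kernel k j = (if j = k then 1 / \<theta> else 0)
     + coupling * (cos (\<theta> * (real k - real j + 1 / 2)) - arc_mean * cos (\<theta> * (real k - real j)))"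

lemma flux_eq_kernel:
  assumes "k \<in> {1..q}"
  shows "flux \<rho> k = (\<Sum>j=1..q. flux_kernel k j * \<rho> j)"
proof -
  have "flux_kernel k j * \<rho> j = (if j = k then \<rho> k / \<theta> else 0) + coupling * (\<rho> j *
     (cos (\<theta> * (real k - real j + 1 / 2)) - arc_mean * cos (\<theta> * (real k - real j))))" for j
    by (simp add: flux_kernel_def algebra_simps)
  then show ?thesis using assms by (simp add: flux_def sum.distrib sum_distrib_left)
qed

definition mode :: "nat \<Rightarrow> nat \<Rightarrow> complex" where
  "mode l k = cis (\<theta> * real l * real k)"

lemma mode_q: "mode l q = 1"
  using q_pos cis_multiple_2pi[of "real l"] by (simp add: mode_def \<theta>_def)

text \<open>The cosine is half a sum of two exponentials, so the products have frequencies
  \<open>l - 1\<close> and \<open>l + 1\<close>. Summation over a full cycle keeps only multiples of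
  \<open>q\<close>, reached here at \<open>l = 1\<close> and \<open>l = q - 1\<close>
  respectively.\<close>

lemma sum_mode_mult_cos:
  assumes l: "l \<in> {1..q - 1}"
  shows "(\<Sum>j=1..q. mode l j * of_real (cos (x - \<theta> * real j)))
    = of_nat q / 2 * ((if l = 1 then cis x else 0) + (if l = q - 1 then cis (- x) else 0))"
proof -
  have cos: "complex_of_real (cos y) = (cis y + cis (- y)) / 2" for y
    by (simp add: complex_eq_iff)
  have "mode l j * of_real (cos (x - \<theta> * real j))
      = cis x / 2 * cis (2 * pi * real_of_int (int l - 1) * real j / real q)
        + cis (- x) / 2 * cis (2 * pi * real_of_int (int l + 1) * real j / real q)" for j
  proof -
    have "\<theta> * real l * real j + (x - \<theta> * real j) = x + 2 * pi * real_of_int (int l - 1) * real j / real q"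
      "\<theta> * real l * real j + - (x - \<theta> * real j) = - x + 2 * pi * real_of_int (int l + 1) * real j / real q"
      by (simp_all add: \<theta>_def algebra_simps diff_divide_distrib add_divide_distrib)
    then have "mode l j * cis (x - \<theta> * real j) = cis x * cis (2 * pi * real_of_int (int l - 1) * real j / real q)"
      "mode l j * cis (- (x - \<theta> * real j)) = cis (- x) * cis (2 * pi * real_of_int (int l + 1) * real j / real q)"
      by (simp_all only: mode_def cis_mult)
    then show ?thesis unfolding cos by (simp add: distrib_left add_divide_distrib)
  qed
  moreover have "int q dvd int l - 1 \<longleftrightarrow> l = 1"
    using l zdvd_imp_le[of "int q" "int l - 1"] by (cases "l = 1") auto
  moreover have "int q dvd int l + 1 \<longleftrightarrow> l = q - 1"
  proof
    assume "int q dvd int l + 1"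
    then have "int q \<le> int l + 1" by (intro zdvd_imp_le) auto
    then show "l = q - 1" using l by auto
  qed (use q_ge_3 in \<open>auto simp: of_nat_diff\<close>)
  ultimately show ?thesis
    using sum_cis_multiples[of q "int l - 1"] sum_cis_multiples[of q "int l + 1"] q_ge_3
    by (simp only: sum.distrib flip: sum_distrib_left) (simp add: algebra_simps)
qed

text \<open>The flux multiplies the mode \<open>l\<close> by \<open>gain l\<close>; the linearisation is the difference of the fluxes
  through adjacent sector boundaries.\<close>

definition gain :: "nat \<Rightarrow> complex" where
  "gain l = of_real (1 / \<theta>)
     + (if l = 1 then of_real (coupling * real q / 2) * (cis (\<theta> / 2) - of_real arc_mean) else 0)
     + (if l = q - 1 then of_real (coupling * real q / 2) * (cis (- \<theta> / 2) - of_real arc_mean) else 0)"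

definition eigenvalue :: "nat \<Rightarrow> complex" where
  "eigenvalue l = (cis (- \<theta> * real l) - 1) * gain l"

lemma flux_kernel_mode:
  assumes l: "l \<in> {1..q - 1}" and k: "k \<in> {1..q}"
  shows "(\<Sum>j=1..q. of_real (flux_kernel k j) * mode l j) = gain l * mode l k"
proof -
  have "of_real (flux_kernel k j) * mode l j = (if j = k then of_real (1 / \<theta>) * mode l k else 0)
     + of_real coupling * (mode l j * of_real (cos (\<theta> * (real k + 1 / 2) - \<theta> * real j)))
     - of_real (coupling * arc_mean) * (mode l j * of_real (cos (\<theta> * real k - \<theta> * real j)))" for j
  proof -
    have "\<theta> * (real k - real j + 1 / 2) = \<theta> * (real k + 1 / 2) - \<theta> * real j"
      "\<theta> * (real k - real j) = \<theta> * real k - \<theta> * real j"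
      by (simp_all add: algebra_simps)
    then show ?thesis unfolding flux_kernel_def by (simp add: algebra_simps)
  qed
  then have "(\<Sum>j=1..q. of_real (flux_kernel k j) * mode l j) = of_real (1 / \<theta>) * mode l k
     + of_real coupling * (\<Sum>j=1..q. mode l j * of_real (cos (\<theta> * (real k + 1 / 2) - \<theta> * real j)))
     - of_real (coupling * arc_mean) * (\<Sum>j=1..q. mode l j * of_real (cos (\<theta> * real k - \<theta> * real j)))"
    using k by (simp add: sum.distrib sum_subtractf sum_distrib_left)
  also have "\<dots> = gain l * mode l k"
  proof -
    have 1: "l = 1 \<Longrightarrow> cis (\<theta> * (real k + 1 / 2)) = cis (\<theta> / 2) * mode l k \<and> cis (\<theta> * real k) = mode l k"
      by (simp add: mode_def cis_mult algebra_simps)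
    have 2: "l = q - 1 \<Longrightarrow> cis (- (\<theta> * (real k + 1 / 2))) = cis (- \<theta> / 2) * mode l k \<and> cis (- (\<theta> * real k)) = mode l k"
    proof -
      assume "l = q - 1"
      then have "\<theta> * real l * real k = - (\<theta> * real k) + 2 * pi * real k"
        using q_ge_3 by (simp add: \<theta>_def of_nat_diff field_simps)
      then have "mode l k = cis (- (\<theta> * real k)) * cis (2 * pi * real k)"
        by (simp only: mode_def cis_mult)
      then have "mode l k = cis (- (\<theta> * real k))"
        using cis_multiple_2pi[of "real k"] by simp
      then show ?thesis by (simp add: cis_mult algebra_simps)
    qed
    \<comment> \<open>\<open>q \<ge> 3\<close> separates the two coupled modes, so at most one
      correction in \<open>gain\<close> is active.\<close>
    have "l = 1 \<Longrightarrow> l \<noteq> q - 1" using q_ge_3 by simp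
    then consider "l = 1" "l \<noteq> q - 1" | "l = q - 1" "l \<noteq> 1" | "l \<noteq> 1" "l \<noteq> q - 1" by blast
    moreover have collect: "of_real (1 / \<theta>) * m + of_real coupling * (of_nat q / 2 * (x * m))
        - of_real (coupling * arc_mean) * (of_nat q / 2 * m)
      = (of_real (1 / \<theta>) + of_real (coupling * real q / 2) * (x - of_real arc_mean)) * m" for x m :: complex
      by (simp add: field_simps)
    ultimately show ?thesis
      unfolding sum_mode_mult_cos[OF l] gain_def
      by cases (simp_all only: 1 2 collect if_True if_False simp_thms add_0_left add_0_right
          mult_zero_right diff_zero)
  qed
  finally show ?thesis .
qed

lemma mode_prev_idx:
  assumes "k \<in> {1..q}"
  shows "mode l (prev_idx q k) = cis (- \<theta> * real l) * mode l k"
proof (cases "k = 1")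
  case True
  then show ?thesis by (simp add: prev_idx_def mode_q) (simp add: mode_def cis_mult)
next
  case False
  then show ?thesis using assms
    by (simp add: prev_idx_def mode_def cis_mult of_nat_diff algebra_simps)
qed

definition Lin_kernel where
  "Lin_kernel k j = flux_kernel (prev_idx q k) j - flux_kernel k j"

lemma Lin_eq_kernel:
  assumes "\<rho> \<in> Vspace q" "k \<in> {1..q}"
  shows "Lin \<beta> q \<rho> k = (\<Sum>j=1..q. Lin_kernel k j * \<rho> j)"
  unfolding Lin_eq[OF assms(1)] Lin_kernel_def
  using assms(2) flux_eq_kernel[OF assms(2), of \<rho>] flux_eq_kernel[OF prev_idx_in[OF assms(2)], of \<rho>]
  by (simp add: left_diff_distrib sum_subtractf)

lemma Lin_kernel_mode:
  assumes "l \<in> {1..q - 1}" "k \<in> {1..q}"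
  shows "(\<Sum>j=1..q. of_real (Lin_kernel k j) * mode l j) = eigenvalue l * mode l k"
  using flux_kernel_mode[OF assms] flux_kernel_mode[OF assms(1) prev_idx_in[OF assms(2)]]
  by (simp add: Lin_kernel_def left_diff_distrib sum_subtractf mode_prev_idx[OF assms(2)] eigenvalue_def
      algebra_simps)

text \<open>Isolates the index \<open>q\<close>, the coordinate eliminated by the basis of
  \<open>Vspace q\<close>, and shifts the others to matrix indices from zero.\<close>

lemma sum_split_last: "(\<Sum>k=1..q. f k) = (\<Sum>k=0..<q - 1. f (Suc k)) + (f q :: 'a::comm_monoid_add)"
proof -
  have "(\<Sum>k=1..Suc (q - 1). f k) = (\<Sum>k=1..q - 1. f k) + f (Suc (q - 1))" by simp
  then show ?thesis using q_ge_3 by (simp add: sum.atLeast1_atMost_eq atLeast0LessThan)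
qed

lemma sum_mode:
  assumes "l \<in> {1..q - 1}"
  shows "(\<Sum>k=1..q. mode l k) = 0"
proof -
  have "mode l k = cis (2 * pi * real_of_int (int l) * real k / real q)" for k
    by (simp add: mode_def \<theta>_def)
  moreover have "\<not> int q dvd int l" using assms by (auto dest: dvd_imp_le)
  ultimately show ?thesis using sum_cis_multiples[of q "int l"] q_ge_3 by simp
qed

section \<open>The matrix of the linearisation in the Fourier basis\<close>

abbreviation "Lin_complex \<equiv> map_mat complex_of_real (Lin_matrix \<beta> q)"
definition "mode_matrix = Matrix.mat (q - 1) (q - 1) (\<lambda>(i, j). mode (Suc j) (Suc i))"
text \<open>The inverse Fourier transform in reduced coordinates. The \<open>- 1\<close> accounts
  for the dropped entry: on \<open>Vspace q\<close> it is minus the sum of the others, and every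
  mode equals \<open>1\<close> at \<open>q\<close>.\<close>

definition "fourier_matrix = Matrix.mat (q - 1) (q - 1) (\<lambda>(i, j). (cnj (mode (Suc i) (Suc j)) - 1) / of_nat q)"

lemma basis_in_Vspace:
  assumes "j \<in> {1..q - 1}"
  shows "(\<lambda>k. unit_vec j k - unit_vec q k) \<in> Vspace q"
  using assms q_ge_3 by (auto simp: Vspace_def Defs.unit_vec_def sum_subtractf)

lemma Lin_matrix_entry:
  assumes "i < q - 1" "j < q - 1"
  shows "Lin_matrix \<beta> q $$ (i, j) = Lin_kernel (Suc i) (Suc j) - Lin_kernel (Suc i) q"
proof -
  have "Lin_matrix \<beta> q $$ (i, j) = Lin \<beta> q (\<lambda>k. unit_vec (Suc j) k - unit_vec q k) (Suc i)"
    using assms by (simp add: Lin_matrix_def)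
  also have "\<dots> = (\<Sum>k=1..q. Lin_kernel (Suc i) k * (unit_vec (Suc j) k - unit_vec q k))"
    using assms by (intro Lin_eq_kernel basis_in_Vspace) auto
  also have "\<dots> = (\<Sum>k=1..q. (if k = Suc j then Lin_kernel (Suc i) k else 0) - (if k = q then Lin_kernel (Suc i) k else 0))"
    by (intro sum.cong) (auto simp: Defs.unit_vec_def)
  also have "\<dots> = Lin_kernel (Suc i) (Suc j) - Lin_kernel (Suc i) q"
    using assms q_ge_3 by (simp add: sum_subtractf)
  finally show ?thesis .
qed

text \<open>A nonconstant mode sums to zero, so its first \<open>q - 1\<close> entries sum to
  \<open>- 1\<close>. The subtracted kernel column \<open>q\<close> thereby becomes the missing
  term, and the truncated product is the full cyclic sum.\<close>

lemma Lin_complex_mode_matrix: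
  "Lin_complex * mode_matrix = mode_matrix * mat_diag (q - 1) (\<lambda>i. eigenvalue (Suc i))"
proof (rule eq_matI)
  fix i j
  assume "i < dim_row (mode_matrix * mat_diag (q - 1) (\<lambda>i. eigenvalue (Suc i)))"
    "j < dim_col (mode_matrix * mat_diag (q - 1) (\<lambda>i. eigenvalue (Suc i)))"
  then have ij: "i < q - 1" "j < q - 1" by (simp_all add: mode_matrix_def mat_diag_def)
  have j: "Suc j \<in> {1..q - 1}" and i: "Suc i \<in> {1..q}" using ij by auto
  have neg: "(\<Sum>k=0..<q - 1. mode (Suc j) (Suc k)) = - 1"
    using sum_mode[OF j] unfolding sum_split_last mode_q by (simp add: eq_neg_iff_add_eq_0)
  have "(Lin_complex * mode_matrix) $$ (i, j)
      = (\<Sum>k=0..<q - 1. of_real (Lin_kernel (Suc i) (Suc k) - Lin_kernel (Suc i) q) * mode (Suc j) (Suc k))"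
    using ij by (simp add: mode_matrix_def scalar_prod_def Lin_matrix_entry Lin_matrix_def[THEN arg_cong[where f = dim_row]]
        Lin_matrix_def[THEN arg_cong[where f = dim_col]])
  also have "\<dots> = (\<Sum>k=0..<q - 1. of_real (Lin_kernel (Suc i) (Suc k)) * mode (Suc j) (Suc k))
      - of_real (Lin_kernel (Suc i) q) * (\<Sum>k=0..<q - 1. mode (Suc j) (Suc k))"
    by (simp add: left_diff_distrib sum_subtractf sum_distrib_left)
  also have "\<dots> = (\<Sum>k=1..q. of_real (Lin_kernel (Suc i) k) * mode (Suc j) k)"
    unfolding sum_split_last neg mode_q by simp
  also have "\<dots> = eigenvalue (Suc j) * mode (Suc j) (Suc i)" by (rule Lin_kernel_mode[OF j i])
  also have "\<dots> = (mode_matrix * mat_diag (q - 1) (\<lambda>i. eigenvalue (Suc i))) $$ (i, j)"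
    using ij by (subst mat_diag_mult_right[of _ "q - 1"]) (auto simp: mode_matrix_def)
  finally show "(Lin_complex * mode_matrix) $$ (i, j)
    = (mode_matrix * mat_diag (q - 1) (\<lambda>i. eigenvalue (Suc i))) $$ (i, j)" .
qed (simp_all add: Lin_matrix_def mode_matrix_def mat_diag_def)

lemma fourier_mode_matrix: "fourier_matrix * mode_matrix = 1\<^sub>m (q - 1)"
proof (rule eq_matI)
  fix i j assume "i < dim_row (1\<^sub>m (q - 1) :: complex mat)" "j < dim_col (1\<^sub>m (q - 1) :: complex mat)"
  then have ij: "i < q - 1" "j < q - 1" by simp_all
  have j: "Suc j \<in> {1..q - 1}" using ij by auto
  have prod: "cnj (mode (Suc i) k) * mode (Suc j) k = cis (2 * pi * real_of_int (int j - int i) * real k / real q)" for k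
    by (simp add: mode_def cis_cnj cis_mult \<theta>_def algebra_simps diff_divide_distrib add_divide_distrib)
  have dvd: "int q dvd int j - int i \<longleftrightarrow> i = j"
  proof
    assume dv: "int q dvd int j - int i"
    then have "int q dvd int i - int j" by (subst dvd_diff_commute)
    with dv show "i = j"
      using ij zdvd_not_zless[of "int j - int i" "int q"] zdvd_not_zless[of "int i - int j" "int q"] by linarith
  qed simp
  have "(fourier_matrix * mode_matrix) $$ (i, j)
     = (\<Sum>k=0..<q - 1. (cnj (mode (Suc i) (Suc k)) - 1) * mode (Suc j) (Suc k)) / of_nat q"
    using ij by (simp add: fourier_matrix_def mode_matrix_def scalar_prod_def sum_divide_distrib)
  \<comment> \<open>The added term at \<open>k = q\<close> is zero because the mode is
    \<open>1\<close> there; over the full cycle the \<open>- 1\<close> part then drops out.\<close>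
  also have "\<dots> = (\<Sum>k=1..q. (cnj (mode (Suc i) k) - 1) * mode (Suc j) k) / of_nat q"
    unfolding sum_split_last by (simp add: mode_q)
  also have "\<dots> = (\<Sum>k=1..q. cis (2 * pi * real_of_int (int j - int i) * real k / real q)) / of_nat q"
    using sum_mode[OF j] by (simp add: left_diff_distrib sum_subtractf prod)
  also have "\<dots> = 1\<^sub>m (q - 1) $$ (i, j)"
    using ij q_ge_3 by (subst sum_cis_multiples) (auto simp: dvd)
  finally show "(fourier_matrix * mode_matrix) $$ (i, j) = 1\<^sub>m (q - 1) $$ (i, j)" .
qed (simp_all add: fourier_matrix_def mode_matrix_def)

sublocale Lin: diagonalized "q - 1" Lin_complex mode_matrix fourier_matrix "\<lambda>i. eigenvalue (Suc i)"
  by unfold_locales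
     (simp_all add: Lin_complex_mode_matrix fourier_mode_matrix,
      simp_all add: Lin_matrix_def mode_matrix_def fourier_matrix_def)

text \<open>As \<open>\<rho>\<close> is real, its mode coordinate is the conjugate of the Fourier
  sum, up to the factor \<open>of_nat q\<close>; the two vanish together.\<close>

lemma fourier_coords:
  assumes \<rho>: "\<rho> \<in> Vspace q" and i: "i < q - 1"
  shows "(fourier_matrix *\<^sub>v map_vec complex_of_real (coords q \<rho>)) $ i
    = cnj (\<Sum>k=1..q. complex_of_real (\<rho> k) * exp (\<i> * complex_of_real (2*pi*real (Suc i)*real k / real q))) / of_nat q"
proof -
  have mode: "exp (\<i> * complex_of_real (2*pi*real (Suc i)*real k / real q)) = mode (Suc i) k" for k
    by (simp add: mode_def \<theta>_def cis_conv_exp)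
  have "(fourier_matrix *\<^sub>v map_vec complex_of_real (coords q \<rho>)) $ i
     = (\<Sum>k=0..<q - 1. (cnj (mode (Suc i) (Suc k)) - 1) * of_real (\<rho> (Suc k))) / of_nat q"
    using i by (simp add: fourier_matrix_def coords_def scalar_prod_def sum_divide_distrib)
  also have "\<dots> = (\<Sum>k=1..q. (cnj (mode (Suc i) k) - 1) * of_real (\<rho> k)) / of_nat q"
    unfolding sum_split_last by (simp add: mode_q)
  also have "\<dots> = ((\<Sum>k=1..q. cnj (mode (Suc i) k) * of_real (\<rho> k)) - of_real (\<Sum>k=1..q. \<rho> k)) / of_nat q"
    by (simp add: left_diff_distrib sum_subtractf)
  also have "complex_of_real (\<Sum>k=1..q. \<rho> k) = 0"
    using \<rho> by (simp add: Vspace_def del: of_real_sum)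
  finally show ?thesis unfolding mode by (simp add: mult.commute)
qed

section \<open>Signs of the real parts and the unstable subspace\<close>

lemma cos_mode_less_1:
  assumes "l \<in> {1..q - 1}"
  shows "cos (\<theta> * real l) < 1"
proof -
  have "0 < \<theta> * real l / 2" using assms theta(1) by simp
  moreover have "\<theta> * real l / 2 < pi" using assms q_ge_3 by (auto simp: \<theta>_def field_simps)
  ultimately have "0 < sin (\<theta> * real l / 2)" by (intro sin_gt_zero)
  then show ?thesis using cos_double_sin[of "\<theta> * real l / 2"] by simp
qed

lemma Re_eigenvalue_neg:
  assumes "l \<in> {2..q - 2}"
  shows "Re (eigenvalue l) < 0"
proof -
  have "l \<in> {1..q - 1}" using assms by auto
  from cos_mode_less_1[OF this] show ?thesis
    using assms theta(1) by (auto simp: eigenvalue_def gain_def divide_neg_pos)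
qed

lemma eigenvalue_cnj: "eigenvalue (q - 1) = cnj (eigenvalue 1)"
proof -
  have "- \<theta> * real (q - 1) = \<theta> - 2 * pi"
    using q_ge_3 by (simp add: \<theta>_def of_nat_diff field_simps)
  then have "cis (- \<theta> * real (q - 1)) = cis \<theta>"
    by (simp add: complex_eq_iff cos_diff sin_diff)
  then show ?thesis
    using q_ge_3 by (auto simp: eigenvalue_def gain_def cis_cnj)
qed

lemma Re_eigenvalue_1_pos:
  assumes "2 < \<beta>"
  shows "0 < Re (eigenvalue 1)"
proof -
  define c where "c = coupling * real q / 2"
  have "Re (eigenvalue 1) = (cos \<theta> - 1) * (1 / \<theta> + c * (cos (\<theta> / 2) - arc_mean)) + sin \<theta> * (c * sin (\<theta> / 2))"
  proof -
    have "1 \<noteq> q - 1" using q_ge_3 by simp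
    then show ?thesis by (simp add: eigenvalue_def gain_def c_def)
  qed
  also have "\<dots> = (1 - cos \<theta>) * (c * arc_mean - 1 / \<theta>)"
  proof -
    \<comment> \<open>Half-angle formulas turn the sine product into a multiple of
      \<open>1 - cos \<theta>\<close>; the \<open>cos (\<theta> / 2)\<close> terms then
      cancel.\<close>
    have "sin \<theta> * sin (\<theta> / 2) = cos (\<theta> / 2) * (1 - cos \<theta>)"
      using sin_double[of "\<theta> / 2"] cos_double_sin[of "\<theta> / 2"] by (simp add: power2_eq_square)
    then have "sin \<theta> * (c * sin (\<theta> / 2)) = c * (cos (\<theta> / 2) * (1 - cos \<theta>))"
      by (simp add: mult.left_commute)
    then show ?thesis by (simp add: algebra_simps)
  qed
  finally have Re: "Re (eigenvalue 1) = (1 - cos \<theta>) * (c * arc_mean - 1 / \<theta>)" .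
  \<comment> \<open>With \<open>response\<close> unfolded and the positive denominator cleared,
    \<open>arc_mean\<close> cancels and exactly \<open>2 < \<beta>\<close> remains.\<close>
  have "1 < \<beta> * arc_mean\<^sup>2 / (2 * (1 - response))"
    using assms response_less_1 by (simp add: response_def field_simps)
  also have "\<dots> = c * arc_mean * \<theta>"
    using q_pos response_less_1 by (simp add: c_def coupling_def \<theta>_def power2_eq_square field_simps)
  finally have "1 / \<theta> < c * arc_mean" using theta(1) by (simp add: pos_divide_less_eq)
  then show ?thesis
    unfolding Re using cos_mode_less_1[of 1] q_ge_3 by (simp add: mult_pos_pos)
qed

lemma mode_cases:
  assumes "i < q - 1"
  obtains "Suc i = 1" | "Suc i = q - 1" | "Suc i \<in> {2..q - 2}"
  using assms by (cases "i = 0"; cases "Suc i = q - 1") auto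

lemma Re_eigenvalue_sign:
  assumes "2 < \<beta>" "i < q - 1"
  shows "Re (eigenvalue (Suc i)) \<noteq> 0"
    and "Re (eigenvalue (Suc i)) \<le> 0 \<longleftrightarrow> Suc i \<in> {2..q - 2}"
proof -
  show "Re (eigenvalue (Suc i)) \<noteq> 0"
    using assms(2) by (rule mode_cases)
      (use Re_eigenvalue_1_pos[OF assms(1)] eigenvalue_cnj Re_eigenvalue_neg[of "Suc i"] in \<open>auto\<close>)
  show "Re (eigenvalue (Suc i)) \<le> 0 \<longleftrightarrow> Suc i \<in> {2..q - 2}"
    using assms(2) by (rule mode_cases)
      (use Re_eigenvalue_1_pos[OF assms(1)] eigenvalue_cnj Re_eigenvalue_neg[of "Suc i"] q_ge_3 in \<open>auto\<close>)
qed

text \<open>Counts the indices that carry \<open>\<mu>\<close>. Modes \<open>2\<close> to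
  \<open>q - 2\<close> are excluded by sign, and the indices \<open>0\<close> and
  \<open>q - 2\<close> are distinct, so the pair would count twice even if its two members
  coincided.\<close>

lemma order_char_poly:
  assumes "2 < \<beta>" "0 < Re \<mu>"
  shows "order \<mu> (char_poly Lin_complex) = count {#eigenvalue 1, cnj (eigenvalue 1)#} \<mu>"
proof -
  have "{i\<in>{..<q - 1}. eigenvalue (Suc i) = \<mu>}
      = (if eigenvalue 1 = \<mu> then {0} else {}) \<union> (if cnj (eigenvalue 1) = \<mu> then {q - 2} else {})" (is "?L = ?R")
  proof (rule Set.set_eqI)
    fix i
    have "\<not> eigenvalue (Suc i) = \<mu>" if "Suc i \<in> {2..q - 2}"
      using Re_eigenvalue_neg[OF that] assms(2) by auto
    moreover have "Suc (q - 2) = q - 1" using q_ge_3 by simp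
    ultimately show "i \<in> ?L \<longleftrightarrow> i \<in> ?R"
      using q_ge_3 eigenvalue_cnj
      by (cases "i = 0"; cases "i = q - 2") auto
  qed
  moreover have "(0::nat) \<noteq> q - 2" using q_ge_3 by simp
  ultimately show ?thesis
    by (simp add: Lin.char_poly_eq order_prod_linear_factors)
qed

lemma Re_root_char_poly:
  assumes "2 < \<beta>" "poly (char_poly Lin_complex) \<mu> = 0"
  shows "Re \<mu> \<noteq> 0"
proof -
  have "\<exists>i<q - 1. \<mu> = eigenvalue (Suc i)"
    using assms(2) by (auto simp: Lin.char_poly_eq poly_prod)
  then show ?thesis using Re_eigenvalue_sign(1)[OF assms(1)] by blast
qed

text \<open>Membership means that all mode coordinates with nonpositive real part vanish. These
  belong to modes \<open>2\<close> to \<open>q - 2\<close>, and \<open>fourier_coords\<close> turns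
  them into the Fourier sums.\<close>

lemma coords_in_unstable_subspace_iff:
  assumes "2 < \<beta>" and \<rho>: "\<rho> \<in> Vspace q"
  shows "coords q \<rho> \<in> unstable_subspace (Lin_matrix \<beta> q) \<longleftrightarrow> (\<forall>l\<in>{2..q-2}.
     (\<Sum>k=1..q. complex_of_real (\<rho> k) * exp (\<i> * complex_of_real (2*pi*real l*real k / real q))) = 0)"
proof -
  have dim: "dim_row (Lin_matrix \<beta> q) = q - 1" by (simp add: Lin_matrix_def)
  have c: "map_vec complex_of_real (coords q \<rho>) \<in> carrier_vec (q - 1)" "coords q \<rho> \<in> carrier_vec (q - 1)"
    by (simp_all add: coords_def)
  have "coords q \<rho> \<in> unstable_subspace (Lin_matrix \<beta> q) \<longleftrightarrow>
     (\<forall>i<q - 1. Re (eigenvalue (Suc i)) \<le> 0 \<longrightarrow> (fourier_matrix *\<^sub>v map_vec complex_of_real (coords q \<rho>)) $ i = 0)"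
    unfolding unstable_subspace_def Let_def dim
    using Lin.sum_of_unstable_iff[OF c(1)] c(2) q_ge_3 by simp
  also have "\<dots> \<longleftrightarrow> (\<forall>i<q - 1. Suc i \<in> {2..q - 2} \<longrightarrow>
     (\<Sum>k=1..q. complex_of_real (\<rho> k) * exp (\<i> * complex_of_real (2*pi*real (Suc i)*real k / real q))) = 0)"
  proof -
    have q: "(of_nat q :: complex) \<noteq> 0" using q_pos by simp
    have "(fourier_matrix *\<^sub>v map_vec complex_of_real (coords q \<rho>)) $ i = 0 \<longleftrightarrow>
     (\<Sum>k=1..q. complex_of_real (\<rho> k) * exp (\<i> * complex_of_real (2*pi*real (Suc i)*real k / real q))) = 0"
      if "i < q - 1" for i
      unfolding fourier_coords[OF \<rho> that] by (simp only: divide_eq_0_iff complex_cnj_zero_iff q simp_thms)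
    then show ?thesis using Re_eigenvalue_sign(2)[OF assms(1)] by blast
  qed
  also have "\<dots> \<longleftrightarrow> (\<forall>l\<in>{2..q-2}.
     (\<Sum>k=1..q. complex_of_real (\<rho> k) * exp (\<i> * complex_of_real (2*pi*real l*real k / real q))) = 0)"
    (is "(\<forall>i<q - 1. Suc i \<in> _ \<longrightarrow> ?S (Suc i) = 0) \<longleftrightarrow> _")
  proof (intro iffI ballI allI impI)
    fix l assume *: "\<forall>i<q - 1. Suc i \<in> {2..q - 2} \<longrightarrow> ?S (Suc i) = 0" and l: "l \<in> {2..q - 2}"
    then obtain i where "l = Suc i" "i < q - 1" by (cases l) auto
    then show "?S l = 0" using * l by blast
  qed blast
  finally show ?thesis .
qed

end

theorem theorem1p9:
  fixes \<beta> :: real and q :: nat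
  assumes "\<beta> > 2"
    and "\<beta> * (sin (pi / real q))^2 < 1"
    and "\<beta> * (1 - real q / (2*pi) * sin (2*pi / real q)) \<le> 2"
  shows
    "(\<forall>\<rho>\<in>Vspace q. \<forall>k. (\<lambda>\<epsilon>. F_field \<beta> q (\<lambda>j. eqdist q j + \<epsilon> * \<rho> j) k) differentiable (at 0))
     \<and> (\<forall>\<rho>\<in>Vspace q. Lin \<beta> q \<rho> \<in> Vspace q)
     \<and> (\<forall>\<rho>\<in>Vspace q. \<forall>\<sigma>\<in>Vspace q. \<forall>a b.
          Lin \<beta> q (\<lambda>k. a * \<rho> k + b * \<sigma> k) = (\<lambda>k. a * Lin \<beta> q \<rho> k + b * Lin \<beta> q \<sigma> k))
     \<and> (let cp = char_poly (map_mat complex_of_real (Lin_matrix \<beta> q)) in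
          (\<exists>z. 0 < Re z \<and>
             (\<forall>\<mu>. 0 < Re \<mu> \<longrightarrow> order \<mu> cp = count {#z, cnj z#} \<mu>)) \<and>
          (\<forall>\<mu>. poly cp \<mu> = 0 \<longrightarrow> Re \<mu> \<noteq> 0))
     \<and> {\<rho>\<in>Vspace q. coords q \<rho> \<in> unstable_subspace (Lin_matrix \<beta> q)}
       = {\<rho>\<in>Vspace q. \<forall>l\<in>{2..q-2}.
            (\<Sum>k=1..q. complex_of_real (\<rho> k) * exp (\<i> * complex_of_real (2*pi*real l*real k / real q))) = 0}"
proof -
  \<comment> \<open>Small \<open>q\<close> contradict the hypotheses. For \<open>q = 0\<close>,
    where division yields zero, and for \<open>q = 1\<close>, where the sine vanishes, the third one
    reads \<open>\<beta> \<le> 2\<close>; for \<open>q = 2\<close> the second reads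
    \<open>\<beta> < 1\<close>.\<close>
  have "q \<noteq> 0" using assms(1,3) by (intro notI) simp
  moreover have "q \<noteq> 1" using assms(1,3) by (intro notI) simp
  moreover have "q \<noteq> 2" using assms(1,2) by (intro notI) simp
  ultimately have "3 \<le> q" by linarith
  then interpret sector_model \<beta> q
    using assms by unfold_locales auto
  show ?thesis
    unfolding Let_def
  proof (intro conjI ballI allI)
    fix \<rho> k assume "\<rho> \<in> Vspace q"
    then show "(\<lambda>\<epsilon>. F_field \<beta> q (\<lambda>j. eqdist q j + \<epsilon> * \<rho> j) k) differentiable (at 0)"
      unfolding real_differentiable_def using F_field_has_derivative by blast
  next
    show "\<exists>z. 0 < Re z \<and> (\<forall>\<mu>. 0 < Re \<mu> \<longrightarrow> order \<mu> (char_poly Lin_complex) = count {#z, cnj z#} \<mu>)"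
      using Re_eigenvalue_1_pos[OF assms(1)] order_char_poly[OF assms(1)] by blast
  next
    show "poly (char_poly Lin_complex) \<mu> = 0 \<longrightarrow> Re \<mu> \<noteq> 0" for \<mu>
      using Re_root_char_poly[OF assms(1)] by blast
  next
    show "{\<rho>\<in>Vspace q. coords q \<rho> \<in> unstable_subspace (Lin_matrix \<beta> q)}
       = {\<rho>\<in>Vspace q. \<forall>l\<in>{2..q-2}.
            (\<Sum>k=1..q. complex_of_real (\<rho> k) * exp (\<i> * complex_of_real (2*pi*real l*real k / real q))) = 0}"
      using coords_in_unstable_subspace_iff[OF assms(1)] by blast
  qed (simp_all only: Lin_in_Vspace Lin_linear)
qed

end
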